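(* Let $(X,\mathcal P(A),C+\rho\Omega,P)$ be a regularized model with discount factor $\beta\in(0,1)$ (as described in the context), and suppose that the Lipschitz assumption on $(c,p)$ holds with constants $L_1,K_1$. Let $\bar L=\frac{L_1}{1-\beta K_1/2}$ and $K_{\mathrm D}=K_1+\min\{1,\frac32K_1\}$. Assume that $$\sqrt\beta\left(\sqrt{K_{\mathrm D}+\frac{\bar LK_1}{\rho}}+\sqrt{\frac{\bar LK_1}{\rho}}\right)<1$$ and that either $K_{\mathrm D}\ge1$ or $\frac{\bar LK_1}{\rho}>\beta(1-K_{\mathrm D})^2$. Then for any $T\in\mathbb N$ and any initial state measure $\mu_{\mathrm{init}}\in\mathcal P(X)$ there exists a unique $(\pi^T_{-t},\mu^T_{-t})_{t=0}^T\in\mathrm{MFE}_{T,\mu_{\mathrm{init}},Q^T_0}$ whose terminal Q-function $Q^T_0$ satisfies $Q^T_0=H_1(Q^T_0,\mu^T_0)$. Furthermore, this $Q^T_0$ can be computed iteratively through a contractive mapping: the map $\Phi_T$ defined in the context is contractive on $\mathcal C_\beta^{T+1}$ with respect to a suitable norm, and the iterates of $\Phi_T$ started from any element of $\mathcal C_\beta^{T+1}$ converge to a fixed point of $\Phi_T$ whose time-$0$ component is $Q^T_0$.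
   Context: Setting. $X$ and $A$ are finite nonempty sets with the discrete metric; $\mathcal P(E)$ is the set of probability measures on $E$; $\mathcal P(X)$, $\mathcal P(A)$ carry the norm $\|\cdot\|_1$. $c:X\times A\times\mathcal P(X)\to[0,\infty)$ is a cost function and $p:X\times A\times\mathcal P(X)\to\mathcal P(X)$ a transition kernel. For $u\in\mathcal P(A)$ put $C(x,u,\mu)=\sum_{a}c(x,a,\mu)u(a)$ and $P(\cdot\mid x,u,\mu)=\sum_a p(\cdot\mid x,a,\mu)u(a)$. $\rho>0$ and $\Omega:\mathcal P(A)\to\mathbb R$ is 1-strongly convex for $\|\cdot\|_1$: $\Omega(\theta u+(1-\theta)v)\le\theta\Omega(u)+(1-\theta)\Omega(v)-\frac12\theta(1-\theta)\|u-v\|_1^2$ for $u,v\in\mathcal P(A)$, $\theta\in[0,1]$. Q-functions are functions $Q:X\times\mathcal P(A)\to\mathbb R$. For $Q$ of the form (affine in $u$) $+\rho\Omega(u)$, $Q(x,\cdot)$ is taken to have a unique minimizer $u_Q(x)\in\mathcal P(A)$, and $\pi_Q(\cdot\mid x)=\delta_{u_Q(x)}$. A policy is a kernel $\pi:X\to\mathcal P(\mathcal P(A))$. Operators: $$H_1(Q,\mu)(x,u)=C(x,u,\mu)+\rho\Omega(u)+\beta\sum_{y\in X}\min_{v\in\mathcal P(A)}Q(y,v)\,P(y\mid x,u,\mu),$$ $$H_2(\pi,\mu)(\cdot)=\sum_{x\in X}\int_{\mathcal P(A)}P(\cdot\mid x,u,\mu)\,\pi(du\mid x)\,\mu(x),\qquad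 H_2(Q,\mu):=H_2(\pi_Q,\mu).$$ Lipschitz assumption. For all $x,\hat x,a,\hat a,\mu,\hat\mu$: $|c(x,a,\mu)-c(\hat x,\hat a,\hat\mu)|\le L_1(1_{\{x\ne\hat x\}}+2\cdot 1_{\{a\ne\hat a\}}+\|\mu-\hat\mu\|_1)$ and $\|p(\cdot|x,a,\mu)-p(\cdot|\hat x,\hat a,\hat\mu)\|_1\le K_1(1_{\{x\ne\hat x\}}+2\cdot1_{\{a\ne\hat a\}}+\|\mu-\hat\mu\|_1)$. It is understood that $\beta K_1<2$. Domain. $M:=\sup C$. $\tilde{\mathcal C}_\beta$ is the set of $q:X\times A\to\mathbb R_+$ with $\|q\|_\infty\le\frac{M}{1-\beta}$ and $|q(x,a)-q(\tilde x,\tilde a)|\le\frac{L_1}{1-\beta K_1/2}(1_{\{x\ne\tilde x\}}+2\cdot1_{\{a\ne\tilde a\}})$. $\mathcal C_\beta$ is the set of $Q(x,u)=\sum_a q(x,a)u(a)+\rho\Omega(u)$ with $q\in\tilde{\mathcal C}_\beta$. $\mathrm{MFE}_{T,\mu_{\mathrm{init}},Q_{\mathrm{terminal}}}$: all families $(\pi_{-t},\mu_{-t})_{t=0}^T$ with $\mu_{-T}=\mu_{\mathrm{init}}$ for which there are Q-functions $(Q_{-t})_{t=0}^T$ with $Q_0=Q_{\mathrm{terminal}}$, $Q_{-t-1}=H_1(Q_{-t},\mu_{-t-1})$, $\mu_{-t}=H_2(\pi_{-t-1},\mu_{-t-1})$ for $0\le t\le T-1$, and $\pi_{-t}(\cdot\mid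 x)$ supported on the minimizers of $Q_{-t}(x,\cdot)$ for $0\le t\le T$, $x\in X$. The map $\Phi_T$. Given $\pmb Q=(Q_{-T},\dots,Q_0)$, put $\mu^{\pmb Q}_{-T}=\mu_{\mathrm{init}}$ and $\mu^{\pmb Q}_{-t+1}=H_2(Q_{-t},\mu^{\pmb Q}_{-t})$ for $t=T,\dots,1$. Then $\Phi_T(\pmb Q)=(Q^{\mathrm{new}}_{-T},\dots,Q^{\mathrm{new}}_0)$ with $Q^{\mathrm{new}}_{-t}=H_1(Q_{-t+1},\mu^{\pmb Q}_{-t})$ for $t=T,\dots,1$ and $Q^{\mathrm{new}}_0=H_1(Q_0,\mu^{\pmb Q}_0)$. *)

theory Defs
  imports "HOL-Analysis.Analysis" "HOL-Probability.Probability"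
begin

text \<open>The finite nonempty sets X and A are types \<open>'x\<close>, \<open>'a\<close> of class \<open>finite\<close>, and P(X), P(A) are
  the types \<open>'x pmf\<close>, \<open>'a pmf\<close>. A Q-function is a function \<open>Q :: 'x \<Rightarrow> 'a pmf \<Rightarrow> real\<close>.
  Families indexed by the times -T, ..., 0 are extensional functions on \<open>{..T}\<close>, the index
  \<open>t\<close> standing for the time -t.\<close>

definition l1_dist :: "'a::finite pmf \<Rightarrow> 'a pmf \<Rightarrow> real" where
  "l1_dist u v = (\<Sum>a\<in>UNIV. \<bar>pmf u a - pmf v a\<bar>)"

text \<open>The convex combination \<open>\<theta> u + (1 - \<theta>) v\<close>, meaningful for \<open>0 \<le> \<theta> \<le> 1\<close>; see \<open>pmf_mix\<close>.\<close>

definition mix_pmf :: "real \<Rightarrow> 'a pmf \<Rightarrow> 'a pmf \<Rightarrow> 'a pmf" where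
  "mix_pmf \<theta> u v = bind_pmf (bernoulli_pmf \<theta>) (\<lambda>b. if b then u else v)"

lemma pmf_mix:
  assumes "0 \<le> \<theta>" "\<theta> \<le> 1"
  shows "pmf (mix_pmf \<theta> u v) a = \<theta> * pmf u a + (1 - \<theta>) * pmf v a"
  using assms by (simp add: mix_pmf_def pmf_bind)

definition strongly_convex_1 :: "('a::finite pmf \<Rightarrow> real) \<Rightarrow> bool" where
  "strongly_convex_1 \<Omega> \<longleftrightarrow> (\<forall>u v. \<forall>\<theta>\<in>{0..1}.
     \<Omega> (mix_pmf \<theta> u v) \<le> \<theta> * \<Omega> u + (1 - \<theta>) * \<Omega> v - 1/2 * \<theta> * (1 - \<theta>) * (l1_dist u v)\<^sup>2)"

text \<open>Strong convexity does not give lower semicontinuity on the boundary of P(A), so existence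
  of minimizers is a separate standing assumption. Since \<open>u\<close> has total mass 1, every affine
  function of \<open>u\<close> has the form \<open>\<Sum>a. q a * u a\<close>.\<close>

definition unique_minimizers :: "real \<Rightarrow> ('a::finite pmf \<Rightarrow> real) \<Rightarrow> bool" where
  "unique_minimizers \<rho> \<Omega> \<longleftrightarrow> (\<forall>q :: 'a \<Rightarrow> real.
     \<exists>!u. is_arg_min (\<lambda>u. (\<Sum>a\<in>UNIV. q a * pmf u a) + \<rho> * \<Omega> u) (\<lambda>_. True) u)"

definition lipschitz_model :: "('x::finite \<Rightarrow> 'a::finite \<Rightarrow> 'x pmf \<Rightarrow> real)
    \<Rightarrow> ('x \<Rightarrow> 'a \<Rightarrow> 'x pmf \<Rightarrow> 'x pmf) \<Rightarrow> real \<Rightarrow> real \<Rightarrow> bool" where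
  "lipschitz_model c p L1 K1 \<longleftrightarrow> 0 \<le> L1 \<and> 0 \<le> K1 \<and>
     (\<forall>x x' a a' \<mu> \<mu>'.
        \<bar>c x a \<mu> - c x' a' \<mu>'\<bar> \<le> L1 * (of_bool (x \<noteq> x') + 2 * of_bool (a \<noteq> a') + l1_dist \<mu> \<mu>') \<and>
        l1_dist (p x a \<mu>) (p x' a' \<mu>')
          \<le> K1 * (of_bool (x \<noteq> x') + 2 * of_bool (a \<noteq> a') + l1_dist \<mu> \<mu>'))"

definition Lbar :: "real \<Rightarrow> real \<Rightarrow> real \<Rightarrow> real" where
  "Lbar \<beta> L1 K1 = L1 / (1 - \<beta> * K1 / 2)"

definition KD :: "real \<Rightarrow> real" where
  "KD K1 = K1 + min 1 (3/2 * K1)"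

definition Cost :: "('x \<Rightarrow> 'a::finite \<Rightarrow> 'x pmf \<Rightarrow> real) \<Rightarrow> 'x \<Rightarrow> 'a pmf \<Rightarrow> 'x pmf \<Rightarrow> real" where
  "Cost c x u \<mu> = (\<Sum>a\<in>UNIV. c x a \<mu> * pmf u a)"

definition Trans :: "('x \<Rightarrow> 'a \<Rightarrow> 'x pmf \<Rightarrow> 'x pmf) \<Rightarrow> 'x \<Rightarrow> 'a pmf \<Rightarrow> 'x pmf \<Rightarrow> 'x pmf" where
  "Trans p x u \<mu> = bind_pmf u (\<lambda>a. p x a \<mu>)"

lemma pmf_Trans: "pmf (Trans p x u \<mu>) y = (\<Sum>a\<in>UNIV. pmf (p x a \<mu>) y * pmf u a)"
  for u :: "'a::finite pmf"
  by (simp add: Trans_def pmf_bind integral_measure_pmf[of UNIV] mult.commute)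

text \<open>The minimum over \<open>v\<close> is written as an infimum. The two agree whenever \<open>Q y\<close> has a minimizer,
  which is the case for every Q-function of the form affine + \<open>\<rho> \<Omega>\<close> and, because of the condition
  on the policies, for every Q-function of a mean field equilibrium.\<close>

definition H1 :: "('x::finite \<Rightarrow> 'a::finite \<Rightarrow> 'x pmf \<Rightarrow> real) \<Rightarrow> ('x \<Rightarrow> 'a \<Rightarrow> 'x pmf \<Rightarrow> 'x pmf)
    \<Rightarrow> real \<Rightarrow> real \<Rightarrow> ('a pmf \<Rightarrow> real)
    \<Rightarrow> ('x \<Rightarrow> 'a pmf \<Rightarrow> real) \<Rightarrow> 'x pmf \<Rightarrow> 'x \<Rightarrow> 'a pmf \<Rightarrow> real" where
  "H1 c p \<beta> \<rho> \<Omega> Q \<mu> = (\<lambda>x u. Cost c x u \<mu> + \<rho> * \<Omega> u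
     + \<beta> * (\<Sum>y\<in>UNIV. (INF v. Q y v) * pmf (Trans p x u \<mu>) y))"

text \<open>The Borel sigma-algebra of P(A), obtained by embedding P(A) into the Euclidean space.\<close>

definition pmf_borel :: "'a::finite pmf measure" where
  "pmf_borel = vimage_algebra UNIV (\<lambda>u. \<chi> a. pmf u a) (borel :: (real^'a) measure)"

definition policies :: "('x \<Rightarrow> 'a::finite pmf measure) set" where
  "policies = {\<pi>. \<forall>x. \<pi> x \<in> space (prob_algebra pmf_borel)}"

definition H2 :: "('x::finite \<Rightarrow> 'a::finite \<Rightarrow> 'x pmf \<Rightarrow> 'x pmf)
    \<Rightarrow> ('x \<Rightarrow> 'a pmf measure) \<Rightarrow> 'x pmf \<Rightarrow> 'x pmf" where
  "H2 p \<pi> \<mu> = embed_pmf (\<lambda>y. \<Sum>x\<in>UNIV. (\<integral>u. pmf (Trans p x u \<mu>) y \<partial>\<pi> x) * pmf \<mu> x)"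

definition greedy_policy :: "('x \<Rightarrow> 'a::finite pmf \<Rightarrow> real) \<Rightarrow> 'x \<Rightarrow> 'a pmf measure" where
  "greedy_policy Q x = return pmf_borel (arg_min (Q x) (\<lambda>_. True))"

text \<open>For a policy, the argument of \<open>embed_pmf\<close> in the definition of \<open>H2\<close> is a mass function (\<open>pmf_H2\<close>).\<close>

lemma measurable_pmf_borel [measurable]:
  "(\<lambda>u. pmf u a) \<in> borel_measurable (pmf_borel :: 'a::finite pmf measure)"
proof -
  have "(\<lambda>u::'a pmf. \<chi> a. pmf u a) \<in> pmf_borel \<rightarrow>\<^sub>M (borel :: (real^'a) measure)"
    unfolding pmf_borel_def by (rule measurable_vimage_algebra1) simp
  moreover have "(\<lambda>w::real^'a. w $ a) \<in> borel_measurable borel"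
    by (intro borel_measurable_continuous_onI continuous_intros)
  ultimately show ?thesis
    using measurable_compose[of "\<lambda>u::'a pmf. \<chi> a. pmf u a" pmf_borel borel "\<lambda>w. w $ a" borel] by simp
qed

lemma pmf_H2:
  fixes p :: "'x::finite \<Rightarrow> 'a::finite \<Rightarrow> 'x pmf \<Rightarrow> 'x pmf"
  assumes "\<pi> \<in> policies"
  shows "pmf (H2 p \<pi> \<mu>) y = (\<Sum>x\<in>UNIV. (\<integral>u. pmf (Trans p x u \<mu>) y \<partial>\<pi> x) * pmf \<mu> x)"
proof -
  let ?g = "\<lambda>x y. \<integral>u. pmf (Trans p x u \<mu>) y \<partial>\<pi> x"
  have sp: "prob_space (\<pi> x)" and st: "sets (\<pi> x) = sets pmf_borel" for x
    using assms by (auto simp: policies_def space_prob_algebra)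
  have meas: "(\<lambda>u. pmf (Trans p x u \<mu>) z) \<in> borel_measurable (\<pi> x)" for x z
    unfolding pmf_Trans measurable_cong_sets[OF st refl] by measurable
  have int: "integrable (\<pi> x) (\<lambda>u. pmf (Trans p x u \<mu>) z)" for x z
  proof -
    interpret prob_space "\<pi> x" by (rule sp)
    show ?thesis by (rule integrable_const_bound[of _ 1]) (auto simp: meas pmf_le_1)
  qed
  have one: "(\<Sum>z\<in>UNIV. ?g x z) = 1" for x
  proof -
    interpret prob_space "\<pi> x" by (rule sp)
    have "(\<Sum>z\<in>UNIV. ?g x z) = (\<integral>u. (\<Sum>z\<in>UNIV. pmf (Trans p x u \<mu>) z) \<partial>\<pi> x)"
      by (rule Bochner_Integration.integral_sum[symmetric]) (rule int)
    also have "\<dots> = 1" by (simp add: sum_pmf_eq_1 prob_space)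
    finally show ?thesis .
  qed
  have "(\<Sum>z\<in>UNIV. \<Sum>x\<in>UNIV. ?g x z * pmf \<mu> x) = (\<Sum>x\<in>UNIV. (\<Sum>z\<in>UNIV. ?g x z) * pmf \<mu> x)"
    by (subst sum.swap) (simp add: sum_distrib_right)
  also have "\<dots> = 1" by (simp add: one sum_pmf_eq_1)
  finally have tot: "(\<Sum>z\<in>UNIV. \<Sum>x\<in>UNIV. ?g x z * pmf \<mu> x) = 1" .
  have nn: "0 \<le> (\<Sum>x\<in>UNIV. ?g x z * pmf \<mu> x)" for z
    by (intro sum_nonneg mult_nonneg_nonneg Bochner_Integration.integral_nonneg) auto
  show ?thesis unfolding H2_def
    by (rule pmf_embed_pmf[OF nn])
       (simp add: nn_integral_count_space_finite nn tot sum_ennreal flip: ennreal_1)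
qed

definition MFE :: "('x::finite \<Rightarrow> 'a::finite \<Rightarrow> 'x pmf \<Rightarrow> real) \<Rightarrow> ('x \<Rightarrow> 'a \<Rightarrow> 'x pmf \<Rightarrow> 'x pmf)
    \<Rightarrow> real \<Rightarrow> real \<Rightarrow> ('a pmf \<Rightarrow> real) \<Rightarrow> nat \<Rightarrow> 'x pmf \<Rightarrow> ('x \<Rightarrow> 'a pmf \<Rightarrow> real)
    \<Rightarrow> ((nat \<Rightarrow> 'x \<Rightarrow> 'a pmf measure) \<times> (nat \<Rightarrow> 'x pmf)) set" where
  "MFE c p \<beta> \<rho> \<Omega> T \<mu>init Qterm = {(\<pi>, \<mu>).
     \<pi> \<in> {..T} \<rightarrow>\<^sub>E policies \<and> \<mu> \<in> {..T} \<rightarrow>\<^sub>E UNIV \<and> \<mu> T = \<mu>init \<and>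
     (\<exists>Q :: nat \<Rightarrow> 'x \<Rightarrow> 'a pmf \<Rightarrow> real.
        Q 0 = Qterm \<and>
        (\<forall>t<T. Q (Suc t) = H1 c p \<beta> \<rho> \<Omega> (Q t) (\<mu> (Suc t)) \<and>
               \<mu> t = H2 p (\<pi> (Suc t)) (\<mu> (Suc t))) \<and>
        (\<forall>t\<le>T. \<forall>x. AE u in \<pi> t x. is_arg_min (Q t x) (\<lambda>_. True) u))}"

text \<open>\<open>flow_from_start p T \<mu>init Q k\<close> is the state measure after \<open>k\<close> steps, that is at time -T + k.\<close>

primrec flow_from_start :: "('x::finite \<Rightarrow> 'a::finite \<Rightarrow> 'x pmf \<Rightarrow> 'x pmf) \<Rightarrow> nat \<Rightarrow> 'x pmf
    \<Rightarrow> (nat \<Rightarrow> 'x \<Rightarrow> 'a pmf \<Rightarrow> real) \<Rightarrow> nat \<Rightarrow> 'x pmf" where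
  "flow_from_start p T \<mu>init Q 0 = \<mu>init"
| "flow_from_start p T \<mu>init Q (Suc k) =
     H2 p (greedy_policy (Q (T - k))) (flow_from_start p T \<mu>init Q k)"

definition flow :: "('x::finite \<Rightarrow> 'a::finite \<Rightarrow> 'x pmf \<Rightarrow> 'x pmf) \<Rightarrow> nat \<Rightarrow> 'x pmf
    \<Rightarrow> (nat \<Rightarrow> 'x \<Rightarrow> 'a pmf \<Rightarrow> real) \<Rightarrow> nat \<Rightarrow> 'x pmf" where
  "flow p T \<mu>init Q t = flow_from_start p T \<mu>init Q (T - t)"

lemma flow_start: "flow p T \<mu>init Q T = \<mu>init"
  by (simp add: flow_def)

lemma flow_step: "t < T \<Longrightarrow>
    flow p T \<mu>init Q t = H2 p (greedy_policy (Q (Suc t))) (flow p T \<mu>init Q (Suc t))"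
  by (simp add: flow_def Suc_diff_Suc[symmetric])

definition Phi :: "('x::finite \<Rightarrow> 'a::finite \<Rightarrow> 'x pmf \<Rightarrow> real) \<Rightarrow> ('x \<Rightarrow> 'a \<Rightarrow> 'x pmf \<Rightarrow> 'x pmf)
    \<Rightarrow> real \<Rightarrow> real \<Rightarrow> ('a pmf \<Rightarrow> real) \<Rightarrow> nat \<Rightarrow> 'x pmf
    \<Rightarrow> (nat \<Rightarrow> 'x \<Rightarrow> 'a pmf \<Rightarrow> real) \<Rightarrow> (nat \<Rightarrow> 'x \<Rightarrow> 'a pmf \<Rightarrow> real)" where
  "Phi c p \<beta> \<rho> \<Omega> T \<mu>init Q = (\<lambda>t\<in>{..T}.
     if t = 0 then H1 c p \<beta> \<rho> \<Omega> (Q 0) (flow p T \<mu>init Q 0)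
     else H1 c p \<beta> \<rho> \<Omega> (Q (t - 1)) (flow p T \<mu>init Q t))"

definition cost_sup :: "('x::finite \<Rightarrow> 'a::finite \<Rightarrow> 'x pmf \<Rightarrow> real) \<Rightarrow> real" where
  "cost_sup c = (SUP (x, u, \<mu>). Cost c x u \<mu>)"

definition C_tilde :: "('x::finite \<Rightarrow> 'a::finite \<Rightarrow> 'x pmf \<Rightarrow> real) \<Rightarrow> real \<Rightarrow> real \<Rightarrow> real
    \<Rightarrow> ('x \<Rightarrow> 'a \<Rightarrow> real) set" where
  "C_tilde c \<beta> L1 K1 = {q.
     (\<forall>x a. 0 \<le> q x a \<and> q x a \<le> cost_sup c / (1 - \<beta>)) \<and>
     (\<forall>x x' a a'. \<bar>q x a - q x' a'\<bar> \<le> Lbar \<beta> L1 K1 * (of_bool (x \<noteq> x') + 2 * of_bool (a \<noteq> a')))}"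

definition C_beta :: "('x::finite \<Rightarrow> 'a::finite \<Rightarrow> 'x pmf \<Rightarrow> real) \<Rightarrow> real \<Rightarrow> real
    \<Rightarrow> ('a pmf \<Rightarrow> real) \<Rightarrow> real \<Rightarrow> real \<Rightarrow> ('x \<Rightarrow> 'a pmf \<Rightarrow> real) set" where
  "C_beta c \<beta> \<rho> \<Omega> L1 K1 =
     (\<lambda>q x u. (\<Sum>a\<in>UNIV. q x a * pmf u a) + \<rho> * \<Omega> u) ` C_tilde c \<beta> L1 K1"

definition bounded_Q_families :: "nat \<Rightarrow> (nat \<Rightarrow> 'x \<Rightarrow> 'a pmf \<Rightarrow> real) set" where
  "bounded_Q_families T = {..T} \<rightarrow>\<^sub>E {Q. bounded (range (\<lambda>(x, u). Q x u))}"

definition Q_diff :: "nat \<Rightarrow> (nat \<Rightarrow> 'x \<Rightarrow> 'a pmf \<Rightarrow> real) \<Rightarrow> (nat \<Rightarrow> 'x \<Rightarrow> 'a pmf \<Rightarrow> real)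
    \<Rightarrow> (nat \<Rightarrow> 'x \<Rightarrow> 'a pmf \<Rightarrow> real)" where
  "Q_diff T Q R = (\<lambda>t\<in>{..T}. \<lambda>x u. Q t x u - R t x u)"

text \<open>\<open>N\<close> is a norm on the vector space \<open>bounded_Q_families T\<close>; nothing is said about its values elsewhere.\<close>

definition Q_norm :: "nat \<Rightarrow> ((nat \<Rightarrow> 'x \<Rightarrow> 'a pmf \<Rightarrow> real) \<Rightarrow> real) \<Rightarrow> bool" where
  "Q_norm T N \<longleftrightarrow>
     (\<forall>Q\<in>bounded_Q_families T. 0 \<le> N Q \<and> (N Q = 0 \<longleftrightarrow> (\<forall>t\<le>T. \<forall>x u. Q t x u = 0))) \<and>
     (\<forall>Q\<in>bounded_Q_families T. \<forall>r. N (\<lambda>t\<in>{..T}. \<lambda>x u. r * Q t x u) = \<bar>r\<bar> * N Q) \<and>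
     (\<forall>Q\<in>bounded_Q_families T. \<forall>R\<in>bounded_Q_families T.
        N (\<lambda>t\<in>{..T}. \<lambda>x u. Q t x u + R t x u) \<le> N Q + N R)"

end

theory Submission
  imports Defs
begin

text \<open>
  Every Q-function in play is \<open>q(x, \<cdot>) + \<rho> \<Omega>\<close> with a cost \<open>q\<close> that is Lipschitz with constant \<open>L = Lbar\<close>. Strong
  convexity makes the minimizers \<open>1/\<rho>\<close>-Lipschitz in \<open>q\<close>, so the distances \<open>\<epsilon>\<^sub>t\<close> of two flows and \<open>\<delta>\<^sub>t\<close> of the
  families generating them satisfy \<open>\<epsilon>\<^sub>t \<le> KD \<epsilon>\<^sub>t\<^sub>+\<^sub>1 + (K1/\<rho>) \<delta>\<^sub>t\<^sub>+\<^sub>1\<close>, and the new families differ by at most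
  \<open>\<beta> \<delta>\<^sub>t\<^sub>-\<^sub>1 + L \<epsilon>\<^sub>t\<close>. In the supremum norm with weights \<open>y ^ t\<close>, where \<open>y \<ge> 1\<close> and \<open>y > KD\<close>, this is a contraction
  with factor \<open>\<beta> y + (L K1/\<rho>) / (y - KD)\<close>; the hypotheses say that some \<open>y\<close> makes it smaller than 1. Equilibria
  with a stationary terminal Q-function are exactly the fixed points of \<open>Phi\<close>, as the support condition
  forces every policy to be the point mass at the unique minimizer.
\<close>

section \<open>Total variation estimates and point masses\<close>

lemma l1_dist_commute: "l1_dist u v = l1_dist v u"
  by (simp add: l1_dist_def abs_minus_commute)

lemma l1_dist_self [simp]: "l1_dist u u = 0"
  by (simp add: l1_dist_def)

lemma l1_dist_nonneg: "0 \<le> l1_dist u v"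
  by (simp add: l1_dist_def sum_nonneg)

lemma l1_dist_triangle: "l1_dist u w \<le> l1_dist u v + l1_dist v w"
  unfolding l1_dist_def sum.distrib[symmetric] by (rule sum_mono) linarith

lemma l1_dist_le_2: "l1_dist u v \<le> 2"
proof -
  have "l1_dist u v \<le> (\<Sum>a\<in>UNIV. pmf u a + pmf v a)"
    unfolding l1_dist_def
    by (rule sum_mono) (smt (verit) pmf_nonneg)
  also have "\<dots> = 2" by (simp add: sum.distrib sum_pmf_eq_1)
  finally show ?thesis .
qed

lemma sum_pmf_diff_eq_0: "(\<Sum>a\<in>UNIV. pmf u a - pmf v a) = 0" for u v :: "'a::finite pmf"
  by (simp add: sum_subtractf sum_pmf_eq_1)

text \<open>Weights of total mass 0 do not see constants, so \<open>m\<close> may be recentred at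
  the midpoint of an interval of length \<open>s\<close> that contains its values; what remains is
  at most \<open>s / 2\<close> in absolute value.\<close>

lemma sum_mult_le_half_oscillation:
  fixes m w :: "'i::finite \<Rightarrow> real"
  assumes "(\<Sum>i\<in>UNIV. w i) = 0" and osc: "\<And>i j. m i - m j \<le> s"
  shows "(\<Sum>i\<in>UNIV. m i * w i) \<le> s / 2 * (\<Sum>i\<in>UNIV. \<bar>w i\<bar>)"
proof -
  define lo where "lo = Min (range m)"
  have lo: "lo \<le> m i" for i by (simp add: lo_def)
  have "lo \<in> range m" by (simp add: lo_def)
  then have hi: "m i \<le> lo + s" for i using osc by (auto simp: algebra_simps)
  have "(\<Sum>i\<in>UNIV. m i * w i) = (\<Sum>i\<in>UNIV. (m i - (lo + s / 2)) * w i)"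
    using assms(1) by (simp add: left_diff_distrib sum_subtractf sum_distrib_left[symmetric])
  also have "\<dots> \<le> (\<Sum>i\<in>UNIV. s / 2 * \<bar>w i\<bar>)"
  proof (rule sum_mono)
    fix i
    have "\<bar>m i - (lo + s / 2)\<bar> \<le> s / 2" using lo[of i] hi[of i] by (simp add: abs_if)
    then have "\<bar>m i - (lo + s / 2)\<bar> * \<bar>w i\<bar> \<le> s / 2 * \<bar>w i\<bar>"
      by (rule mult_right_mono) simp
    then show "(m i - (lo + s / 2)) * w i \<le> s / 2 * \<bar>w i\<bar>"
      unfolding abs_mult[symmetric] by (rule order_trans[OF abs_ge_self])
  qed
  finally show ?thesis by (simp add: sum_distrib_left)
qed

text \<open>Exchanging the two measures gives the other sign. The half gained here is the source of
  \<open>\<beta> * K1 / 2\<close> in \<open>Lbar\<close> and of \<open>3/2 * K1\<close> in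
  \<open>KD\<close>.\<close>

lemma abs_sum_pmf_diff_le:
  fixes m :: "'i::finite \<Rightarrow> real"
  assumes "\<And>i j. m i - m j \<le> s"
  shows "\<bar>\<Sum>i\<in>UNIV. m i * (pmf \<mu> i - pmf \<nu> i)\<bar> \<le> s / 2 * l1_dist \<mu> \<nu>"
proof -
  have "(\<Sum>i\<in>UNIV. m i * (pmf \<mu> i - pmf \<nu> i)) \<le> s / 2 * l1_dist \<mu> \<nu>" for \<mu> \<nu> :: "'i pmf"
    unfolding l1_dist_def by (rule sum_mult_le_half_oscillation[OF sum_pmf_diff_eq_0 assms])
  from this[of \<mu> \<nu>] this[of \<nu> \<mu>] show ?thesis
    by (simp add: abs_if l1_dist_commute[of \<nu> \<mu>] sum_subtractf right_diff_distrib)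
qed

text \<open>Testing against the signs of the coordinates reduces this to the scalar case.\<close>

lemma l1_norm_mixture_diff_le:
  fixes F :: "'i::finite \<Rightarrow> 'j::finite \<Rightarrow> real"
  assumes "\<And>i k. (\<Sum>j\<in>UNIV. \<bar>F i j - F k j\<bar>) \<le> s"
  shows "(\<Sum>j\<in>UNIV. \<bar>\<Sum>i\<in>UNIV. F i j * (pmf \<mu> i - pmf \<nu> i)\<bar>) \<le> s / 2 * l1_dist \<mu> \<nu>"
proof -
  let ?w = "\<lambda>i. pmf \<mu> i - pmf \<nu> i"
  define \<sigma> where "\<sigma> j = sgn (\<Sum>i\<in>UNIV. F i j * ?w i)" for j
  have osc: "(\<Sum>j\<in>UNIV. \<sigma> j * F i j) - (\<Sum>j\<in>UNIV. \<sigma> j * F k j) \<le> s" for i k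
  proof -
    have "(\<Sum>j\<in>UNIV. \<sigma> j * F i j) - (\<Sum>j\<in>UNIV. \<sigma> j * F k j) = (\<Sum>j\<in>UNIV. \<sigma> j * (F i j - F k j))"
      by (simp add: sum_subtractf right_diff_distrib)
    also have "\<dots> \<le> (\<Sum>j\<in>UNIV. \<bar>F i j - F k j\<bar>)"
      by (rule sum_mono) (auto simp: \<sigma>_def sgn_if)
    finally show ?thesis using assms[of i k] by linarith
  qed
  have "(\<Sum>j\<in>UNIV. \<bar>\<Sum>i\<in>UNIV. F i j * ?w i\<bar>) = (\<Sum>j\<in>UNIV. \<sigma> j * (\<Sum>i\<in>UNIV. F i j * ?w i))"
    by (simp add: \<sigma>_def abs_sgn mult.commute)
  also have "\<dots> = (\<Sum>i\<in>UNIV. (\<Sum>j\<in>UNIV. \<sigma> j * F i j) * ?w i)"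
    by (simp add: sum_distrib_left sum_distrib_right mult.assoc) (rule sum.swap)
  also have "\<dots> \<le> s / 2 * l1_dist \<mu> \<nu>"
    using abs_sum_pmf_diff_le[OF osc] by (rule order_trans[OF abs_ge_self])
  finally show ?thesis .
qed

lemma expectation_pmf_mono:
  fixes f g :: "'i::finite \<Rightarrow> real"
  assumes "\<And>i. f i \<le> g i"
  shows "(\<Sum>i\<in>UNIV. f i * pmf u i) \<le> (\<Sum>i\<in>UNIV. g i * pmf u i)"
  by (rule sum_mono, rule mult_right_mono) (simp_all add: assms)

lemma expectation_pmf_le:
  fixes f :: "'i::finite \<Rightarrow> real"
  assumes "\<And>i. f i \<le> s"
  shows "(\<Sum>i\<in>UNIV. f i * pmf u i) \<le> s"
proof -
  have "(\<Sum>i\<in>UNIV. f i * pmf u i) \<le> (\<Sum>i\<in>UNIV. s * pmf u i)"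
    using assms by (rule expectation_pmf_mono)
  also have "\<dots> = s" unfolding sum_distrib_left[symmetric] by (simp add: sum_pmf_eq_1)
  finally show ?thesis .
qed

lemma abs_expectation_pmf_le:
  fixes f :: "'i::finite \<Rightarrow> real"
  assumes "\<And>i. \<bar>f i\<bar> \<le> s"
  shows "\<bar>\<Sum>i\<in>UNIV. f i * pmf u i\<bar> \<le> s"
proof (rule abs_leI)
  show "(\<Sum>i\<in>UNIV. f i * pmf u i) \<le> s"
    using assms by (intro expectation_pmf_le) (simp add: abs_le_iff)
  have "(\<Sum>i\<in>UNIV. - f i * pmf u i) \<le> s"
    using assms by (intro expectation_pmf_le) (simp add: abs_le_iff)
  then show "- (\<Sum>i\<in>UNIV. f i * pmf u i) \<le> s" by (simp add: sum_negf)
qed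

lemma expectation_return_pmf:
  fixes f :: "'i::finite \<Rightarrow> real"
  shows "(\<Sum>i\<in>UNIV. f i * pmf (return_pmf k) i) = f k"
proof -
  have "f i * pmf (return_pmf k) i = (if i = k then f i else 0)" for i
    by (simp add: indicator_def)
  then show ?thesis by simp
qed

lemma l1_norm_mixture_le:
  fixes F :: "'i::finite \<Rightarrow> 'j::finite \<Rightarrow> real"
  assumes "\<And>i. (\<Sum>j\<in>UNIV. \<bar>F i j\<bar>) \<le> s"
  shows "(\<Sum>j\<in>UNIV. \<bar>\<Sum>i\<in>UNIV. F i j * pmf u i\<bar>) \<le> s"
proof -
  have "(\<Sum>j\<in>UNIV. \<bar>\<Sum>i\<in>UNIV. F i j * pmf u i\<bar>) \<le> (\<Sum>j\<in>UNIV. \<Sum>i\<in>UNIV. \<bar>F i j\<bar> * pmf u i)"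
    by (intro sum_mono order_trans[OF sum_abs]) (simp add: abs_mult)
  also have "\<dots> = (\<Sum>i\<in>UNIV. (\<Sum>j\<in>UNIV. \<bar>F i j\<bar>) * pmf u i)"
    by (subst sum.swap) (simp add: sum_distrib_right)
  also have "\<dots> \<le> s" using assms by (rule expectation_pmf_le)
  finally show ?thesis .
qed

text \<open>Point masses are measurable since \<open>pmf_borel\<close> is pulled back along an injection into a Hausdorff space.\<close>

lemma singleton_in_sets_pmf_borel: "{u} \<in> sets (pmf_borel :: 'a::finite pmf measure)"
proof -
  have "{u} = (\<lambda>u. \<chi> a. pmf u a) -` {\<chi> a. pmf u a} \<inter> UNIV"
    by (auto simp: vec_eq_iff intro: pmf_eqI)
  then show ?thesis unfolding pmf_borel_def
    by (metis in_vimage_algebra borel_closed closed_singleton)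
qed

lemma space_pmf_borel [simp]: "space pmf_borel = UNIV"
  by (simp add: pmf_borel_def)

text \<open>Every measurable set has mass 1 or 0 according to whether it contains \<open>a\<close>.
  This turns the support condition on equilibrium policies into an equation between
  measures.\<close>

lemma prob_space_eq_return:
  assumes "prob_space M" and s: "sets M = sets N" and ae: "AE x in M. x = a"
  shows "M = return N a"
proof (rule measure_eqI)
  interpret prob_space M by fact
  fix A assume A: "A \<in> sets M"
  show "emeasure M A = emeasure (return N a) A"
  proof (cases "a \<in> A")
    case True
    have "AE x in M. x \<in> A" using ae by eventually_elim (use True in simp)
    with A have "emeasure M A = 1" by (rule emeasure_eq_1_AE)
    then show ?thesis using True A by (simp add: s)
  next
    case False
    have "AE x in M. x \<notin> A" using ae by eventually_elim (use False in simp)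
    moreover have "{x \<in> space M. \<not> x \<notin> A} = A" using sets.sets_into_space[OF A] by blast
    ultimately have "emeasure M A = 0" by (simp add: AE_iff_measurable[OF A])
    then show ?thesis using False A by (simp add: s)
  qed
qed (simp add: s)

section \<open>Greedy policies and the state measures they produce\<close>

lemma greedy_policy_in_policies: "greedy_policy Q \<in> policies"
  by (auto simp: policies_def greedy_policy_def space_prob_algebra intro: prob_space_return)

lemma AE_greedy_policy:
  fixes Q :: "'x \<Rightarrow> 'a::finite pmf \<Rightarrow> real"
  shows "AE u in greedy_policy Q x. u = arg_min (Q x) (\<lambda>_. True)"
proof -
  have "{u. u = arg_min (Q x) (\<lambda>_. True)} \<in> sets pmf_borel"
    by (simp add: singleton_in_sets_pmf_borel)
  then show ?thesis unfolding greedy_policy_def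
    by (subst AE_return) (auto simp: pred_def)
qed

lemma pmf_H2_greedy:
  fixes p :: "'x::finite \<Rightarrow> 'a::finite \<Rightarrow> 'x pmf \<Rightarrow> 'x pmf"
  shows "pmf (H2 p (greedy_policy Q) \<mu>) y
    = (\<Sum>x\<in>UNIV. pmf (Trans p x (arg_min (Q x) (\<lambda>_. True)) \<mu>) y * pmf \<mu> x)"
proof -
  have "(\<lambda>u. pmf (Trans p x u \<mu>) y) \<in> borel_measurable pmf_borel" for x
    unfolding pmf_Trans by measurable
  then show ?thesis
    by (simp add: pmf_H2[OF greedy_policy_in_policies] greedy_policy_def integral_return)
qed

text \<open>The remainder \<open>l - s n\<close> telescopes into a tail dominated by a geometric
  series. Applied to each coefficient separately, this is the completeness behind the fixed point of
  \<open>sweep\<close>.\<close>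

lemma geometric_increments_limit:
  fixes s :: "nat \<Rightarrow> real"
  assumes "0 \<le> \<kappa>" "\<kappa> < 1" and inc: "\<And>n. \<bar>s (Suc n) - s n\<bar> \<le> \<kappa> ^ n * B"
  shows "\<exists>l. \<forall>n. \<bar>l - s n\<bar> \<le> \<kappa> ^ n * (B / (1 - \<kappa>))"
proof -
  let ?d = "\<lambda>n. s (Suc n) - s n"
  have geo: "summable (\<lambda>k. \<kappa> ^ (k + n) * B)" for n
    using assms by (intro summable_mult2 summable_ignore_initial_segment summable_geometric) simp
  have sd: "summable ?d"
    using geo[of 0] by (rule summable_comparison_test[rotated]) (auto intro: inc)
  define l where "l = s 0 + suminf ?d"
  have "\<bar>l - s n\<bar> \<le> \<kappa> ^ n * (B / (1 - \<kappa>))" for n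
  proof -
    have "l - s n = (\<Sum>k. ?d (k + n))"
      using suminf_split_initial_segment[OF sd, of n] by (simp add: l_def sum_lessThan_telescope)
    also have "\<bar>\<dots>\<bar> \<le> (\<Sum>k. \<kappa> ^ (k + n) * B)"
    proof -
      have sa: "summable (\<lambda>k. \<bar>?d (k + n)\<bar>)"
        using geo[of n] by (rule summable_comparison_test[rotated]) (auto intro: inc)
      show ?thesis
        by (rule order_trans[OF summable_rabs[OF sa] suminf_le[OF inc sa geo]])
    qed
    also have "\<dots> = \<kappa> ^ n * B * (\<Sum>k. \<kappa> ^ k)"
      using assms by (subst suminf_mult[symmetric]) (auto simp: power_add mult_ac intro: summable_geometric)
    also have "\<dots> = \<kappa> ^ n * (B / (1 - \<kappa>))" using assms by (simp add: suminf_geometric)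
    finally show ?thesis .
  qed
  then show ?thesis by blast
qed

section \<open>Regularized costs and the Bellman operator\<close>

locale regularized_model =
  fixes c :: "'x::finite \<Rightarrow> 'a::finite \<Rightarrow> 'x pmf \<Rightarrow> real"
    and p :: "'x \<Rightarrow> 'a \<Rightarrow> 'x pmf \<Rightarrow> 'x pmf"
    and \<Omega> :: "'a pmf \<Rightarrow> real"
    and \<beta> \<rho> L1 K1 :: real
  assumes beta: "0 < \<beta>" "\<beta> < 1"
    and rho: "0 < \<rho>"
    and convex: "strongly_convex_1 \<Omega>"
    and minimizers: "unique_minimizers \<rho> \<Omega>"
    and model: "lipschitz_model c p L1 K1"
    and beta_K1: "\<beta> * K1 < 2"
begin

text \<open>A Q-function is encoded by its affine coefficients \<open>f\<close>, one such
  \<open>f\<close> for each state, so that all estimates concern finitely many real numbers.\<close>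

definition reg :: "('a \<Rightarrow> real) \<Rightarrow> 'a pmf \<Rightarrow> real" where
  "reg f u = (\<Sum>a\<in>UNIV. f a * pmf u a) + \<rho> * \<Omega> u"

definition opt :: "('a \<Rightarrow> real) \<Rightarrow> 'a pmf" where
  "opt f = arg_min (reg f) (\<lambda>_. True)"

definition val :: "('a \<Rightarrow> real) \<Rightarrow> real" where
  "val f = reg f (opt f)"

lemma is_arg_min_reg_iff: "is_arg_min (reg f) (\<lambda>_. True) v \<longleftrightarrow> v = opt f"
proof -
  have ex1: "\<exists>!u. is_arg_min (reg f) (\<lambda>_. True) u"
    using minimizers by (simp add: unique_minimizers_def reg_def[abs_def])
  then have "is_arg_min (reg f) (\<lambda>_. True) (opt f)"
    unfolding opt_def arg_min_def by (blast intro: someI2)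
  with ex1 show ?thesis by blast
qed

lemma val_le: "val f \<le> reg f v"
  using is_arg_min_reg_iff[of f "opt f"] by (simp add: val_def is_arg_min_linorder)

lemma INF_reg: "(INF v. reg f v) = val f"
  by (rule cInf_eq_minimum) (auto simp: val_le, simp add: val_def)

text \<open>Point masses recover the coefficients, so equations between Q-functions can be read as
  equations between coefficients.\<close>

lemma reg_inject: "reg f = reg g \<longleftrightarrow> f = g"
proof
  assume eq: "reg f = reg g"
  show "f = g"
  proof
    fix a
    show "f a = g a" using fun_cong[OF eq, of "return_pmf a"] by (simp add: reg_def expectation_return_pmf)
  qed
qed simp

lemma reg_fam_inject:
  assumes "(\<lambda>x. reg (f x)) = (\<lambda>x. reg (g x))"
  shows "f = g"
proof
  fix x
  show "f x = g x" using fun_cong[OF assms, of x] by (simp only: reg_inject)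
qed

lemma reg_diff: "reg f u - reg g u = (\<Sum>a\<in>UNIV. (f a - g a) * pmf u a)"
  by (simp add: reg_def left_diff_distrib sum_subtractf)

lemma reg_mix_le:
  assumes "0 \<le> \<theta>" "\<theta> \<le> 1"
  shows "reg f (mix_pmf \<theta> u v)
    \<le> \<theta> * reg f u + (1 - \<theta>) * reg f v - \<rho> / 2 * \<theta> * (1 - \<theta>) * (l1_dist u v)\<^sup>2"
proof -
  have "\<Omega> (mix_pmf \<theta> u v)
      \<le> \<theta> * \<Omega> u + (1 - \<theta>) * \<Omega> v - 1/2 * \<theta> * (1 - \<theta>) * (l1_dist u v)\<^sup>2"
    using convex assms by (simp add: strongly_convex_1_def)
  moreover have "(\<Sum>a\<in>UNIV. f a * pmf (mix_pmf \<theta> u v) a)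
      = \<theta> * (\<Sum>a\<in>UNIV. f a * pmf u a) + (1 - \<theta>) * (\<Sum>a\<in>UNIV. f a * pmf v a)"
    unfolding sum_distrib_left sum.distrib[symmetric] pmf_mix[OF assms]
    by (rule sum.cong) (auto simp: algebra_simps)
  moreover from mult_left_mono[OF calculation(1), of \<rho>] rho
  have "\<rho> * \<Omega> (mix_pmf \<theta> u v)
      \<le> \<rho> * (\<theta> * \<Omega> u + (1 - \<theta>) * \<Omega> v - 1/2 * \<theta> * (1 - \<theta>) * (l1_dist u v)\<^sup>2)"
    by simp
  ultimately show ?thesis unfolding reg_def by (simp add: algebra_simps)
qed

text \<open>Quadratic growth at the minimizer: compare \<open>val f\<close> with the mixture that
  puts weight \<open>z\<close> on \<open>opt f\<close>, divide by \<open>1 - z\<close> and let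
  \<open>z\<close> tend to 1.\<close>

lemma reg_ge_val_plus_quadratic: "val f + \<rho> / 2 * (l1_dist v (opt f))\<^sup>2 \<le> reg f v"
proof -
  have "\<rho> / 2 * (l1_dist v (opt f))\<^sup>2 \<le> reg f v - val f"
  proof (rule field_le_mult_one_interval)
    fix z :: real assume z: "0 < z" "z < 1"
    have "val f \<le> (1 - z) * reg f v + z * val f - \<rho> / 2 * (1 - z) * z * (l1_dist v (opt f))\<^sup>2"
      using reg_mix_le[of "1 - z" f v "opt f"] val_le[of f "mix_pmf (1 - z) v (opt f)"] z
      by (simp add: val_def)
    then have "(1 - z) * (z * (\<rho> / 2 * (l1_dist v (opt f))\<^sup>2)) \<le> (1 - z) * (reg f v - val f)"
      by (simp add: algebra_simps)
    then show "z * (\<rho> / 2 * (l1_dist v (opt f))\<^sup>2) \<le> reg f v - val f" using z by simp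
  qed
  then show ?thesis by simp
qed

text \<open>Add the quadratic growth of \<open>reg f\<close> at \<open>opt g\<close> to that of
  \<open>reg g\<close> at \<open>opt f\<close>. The regularizer cancels, and \<open>f - g\<close>
  oscillates by at most \<open>2 * D\<close>, so the squared distance times \<open>\<rho>\<close> is
  at most \<open>D\<close> times the distance.\<close>

lemma opt_lipschitz:
  assumes "\<And>a. \<bar>f a - g a\<bar> \<le> D"
  shows "l1_dist (opt f) (opt g) \<le> D / \<rho>"
proof -
  let ?u = "opt f" and ?v = "opt g"
  define d where "d = l1_dist ?u ?v"
  have "\<rho> * d\<^sup>2 \<le> (reg f ?v - reg g ?v) - (reg f ?u - reg g ?u)"
    using reg_ge_val_plus_quadratic[of f ?v] reg_ge_val_plus_quadratic[of g ?u]
    unfolding val_def d_def l1_dist_commute[of ?v ?u] by argo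
  also have "\<dots> = (\<Sum>a\<in>UNIV. (f a - g a) * (pmf ?v a - pmf ?u a))"
    by (simp add: reg_def algebra_simps sum_subtractf sum.distrib)
  also have "\<dots> \<le> 2 * D / 2 * l1_dist ?v ?u"
  proof (rule order_trans[OF abs_ge_self abs_sum_pmf_diff_le])
    fix i j show "f i - g i - (f j - g j) \<le> 2 * D" using assms[of i] assms[of j] by linarith
  qed
  finally have "d * (\<rho> * d) \<le> d * D"
    by (simp add: d_def l1_dist_commute[of ?v ?u] power2_eq_square algebra_simps)
  \<comment> \<open>If \<open>d = 0\<close> there is nothing to cancel and the claim is just
    \<open>0 \<le> D\<close>, which any index supplies.\<close>
  moreover have "0 \<le> d" "0 \<le> D" using assms[of undefined] by (simp_all add: d_def l1_dist_nonneg)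
  ultimately have "\<rho> * d \<le> D" by (cases "d = 0") auto
  then show ?thesis using rho by (simp add: d_def field_simps)
qed

text \<open>The minimizer of \<open>g\<close> is a competitor for \<open>f\<close>. Used in both
  orders, this makes \<open>val\<close> nonexpansive for the supremum norm.\<close>

lemma val_mono_add:
  assumes "\<And>a. f a - g a \<le> D"
  shows "val f - val g \<le> D"
proof -
  have "val f - val g \<le> reg f (opt g) - reg g (opt g)" using val_le[of f "opt g"] by (simp add: val_def)
  also have "\<dots> = (\<Sum>a\<in>UNIV. (f a - g a) * pmf (opt g) a)"
    by (rule reg_diff)
  also have "\<dots> \<le> D" using assms by (rule expectation_pmf_le)
  finally show ?thesis .
qed


text \<open>A convex function on a simplex is largest at a vertex. The induction splits
  \<open>u\<close> into the point mass at \<open>a\<close> and the conditional law off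
  \<open>a\<close>. With the existence of minimizers this bounds \<open>\<Omega>\<close> on both
  sides although no continuity is assumed.\<close>

lemma Omega_le_vertices:
  assumes "finite S" "set_pmf u \<subseteq> S"
  shows "\<Omega> u \<le> Max (range (\<lambda>a. \<Omega> (return_pmf a)))" (is "_ \<le> ?M")
  using assms
proof (induction S arbitrary: u rule: finite_induct)
  case empty
  then show ?case using set_pmf_not_empty[of u] by simp
next
  case (insert a S)
  have vertex: "\<Omega> (return_pmf a) \<le> ?M" by simp
  show ?case
  proof (cases "set_pmf u \<subseteq> {a}")
    case True
    then show ?thesis using vertex by (simp add: set_pmf_subset_singleton)
  next
    case False
    define \<theta> where "\<theta> = pmf u a"
    define v where "v = cond_pmf u (- {a})"
    have ne: "set_pmf u \<inter> - {a} \<noteq> {}" using False by auto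
    have meas: "measure (measure_pmf u) (- {a}) = 1 - \<theta>"
      using measure_pmf.prob_compl[of "{a}" u] by (simp add: \<theta>_def measure_pmf_single Compl_eq_Diff_UNIV)
    have \<theta>: "0 \<le> \<theta>" "\<theta> \<le> 1" by (simp_all add: \<theta>_def pmf_le_1)
    have "1 - \<theta> \<noteq> 0" using ne meas by (metis measure_measure_pmf_not_zero inf_commute)
    then have u: "u = mix_pmf \<theta> (return_pmf a) v"
      by (intro pmf_eqI) (auto simp: pmf_mix[OF \<theta>] v_def pmf_cond[OF ne] meas \<theta>_def[symmetric])
    have "set_pmf v \<subseteq> S" using insert.prems by (auto simp: v_def set_cond_pmf[OF ne])
    then have "\<Omega> v \<le> ?M" by (rule insert.IH)
    have "\<Omega> u \<le> \<theta> * \<Omega> (return_pmf a) + (1 - \<theta>) * \<Omega> v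
        - 1/2 * \<theta> * (1 - \<theta>) * (l1_dist (return_pmf a) v)\<^sup>2"
      unfolding u using convex \<theta> by (simp add: strongly_convex_1_def)
    also have "\<dots> \<le> \<theta> * ?M + (1 - \<theta>) * ?M - 0"
      using \<theta> vertex \<open>\<Omega> v \<le> ?M\<close>
      by (intro diff_mono add_mono mult_left_mono mult_nonneg_nonneg) auto
    finally show ?thesis by (simp add: algebra_simps)
  qed
qed

lemma reg_bounded: "\<exists>B. \<forall>u. \<bar>reg f u\<bar> \<le> B"
proof -
  define F where "F = Max (range f)"
  define M where "M = Max (range (\<lambda>a. \<Omega> (return_pmf a)))"
  have "reg f u \<le> F + \<rho> * M" for u
    unfolding reg_def F_def M_def using rho
    by (intro add_mono expectation_pmf_le mult_left_mono Omega_le_vertices[of UNIV]) auto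
  then have "\<bar>reg f u\<bar> \<le> \<bar>F + \<rho> * M\<bar> + \<bar>val f\<bar>" for u
    using val_le[of f u] by (smt (verit))
  then show ?thesis by blast
qed

section \<open>The Bellman operator on Lipschitz costs\<close>

abbreviation L :: real where "L \<equiv> Lbar \<beta> L1 K1"

definition lipschitz_cost :: "real \<Rightarrow> ('x \<Rightarrow> 'a \<Rightarrow> real) \<Rightarrow> bool" where
  "lipschitz_cost l q \<longleftrightarrow>
     (\<forall>x x' a a'. \<bar>q x a - q x' a'\<bar> \<le> l * (of_bool (x \<noteq> x') + 2 * of_bool (a \<noteq> a')))"

text \<open>The operator that \<open>H1\<close> induces on coefficients; see
  \<open>H1_reg\<close>.\<close>

definition bellman :: "('x \<Rightarrow> 'a \<Rightarrow> real) \<Rightarrow> 'x pmf \<Rightarrow> 'x \<Rightarrow> 'a \<Rightarrow> real" where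
  "bellman q \<mu> x a = c x a \<mu> + \<beta> * (\<Sum>y\<in>UNIV. val (q y) * pmf (p x a \<mu>) y)"

lemma L1_nonneg: "0 \<le> L1" and K1_nonneg: "0 \<le> K1"
  using model by (auto simp: lipschitz_model_def)

lemma c_lipschitz:
  "\<bar>c x a \<mu> - c x' a' \<mu>'\<bar> \<le> L1 * (of_bool (x \<noteq> x') + 2 * of_bool (a \<noteq> a') + l1_dist \<mu> \<mu>')"
  and p_lipschitz: "l1_dist (p x a \<mu>) (p x' a' \<mu>')
    \<le> K1 * (of_bool (x \<noteq> x') + 2 * of_bool (a \<noteq> a') + l1_dist \<mu> \<mu>')"
  using model by (auto simp: lipschitz_model_def)

lemma L_nonneg: "0 \<le> L"
  using L1_nonneg beta_K1 by (simp add: Lbar_def)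

text \<open>One Bellman step maps the Lipschitz constant \<open>l\<close> to
  \<open>L1 + \<beta> * (l / 2 * K1)\<close>; \<open>L\<close> is the constant reproduced by this
  map.\<close>

lemma L_fixed_point: "L1 + \<beta> * (L / 2 * K1) = L"
  using beta_K1 by (simp add: Lbar_def field_simps)

text \<open>\<open>Q\<close> is arbitrary here: linearity of \<open>Trans\<close> in
  \<open>u\<close> alone gives the regularized form. The terminal function of an equilibrium
  acquires its form this way.\<close>

lemma H1_eq_reg:
  "H1 c p \<beta> \<rho> \<Omega> Q \<mu>
    = (\<lambda>x. reg (\<lambda>a. c x a \<mu> + \<beta> * (\<Sum>y\<in>UNIV. (INF v. Q y v) * pmf (p x a \<mu>) y)))"
proof (intro ext)
  fix x u
  let ?m = "\<lambda>y. INF v. Q y v"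
  define S where "S a = (\<Sum>y\<in>UNIV. ?m y * pmf (p x a \<mu>) y)" for a
  have "(\<Sum>y\<in>UNIV. ?m y * pmf (Trans p x u \<mu>) y)
      = (\<Sum>y\<in>UNIV. \<Sum>a\<in>UNIV. ?m y * pmf (p x a \<mu>) y * pmf u a)"
    by (simp add: pmf_Trans sum_distrib_left mult.assoc)
  also have "\<dots> = (\<Sum>a\<in>UNIV. (\<Sum>y\<in>UNIV. ?m y * pmf (p x a \<mu>) y) * pmf u a)"
    by (subst sum.swap) (simp add: sum_distrib_right)
  finally have mean: "(\<Sum>y\<in>UNIV. ?m y * pmf (Trans p x u \<mu>) y) = (\<Sum>a\<in>UNIV. S a * pmf u a)"
    by (simp add: S_def)
  show "H1 c p \<beta> \<rho> \<Omega> Q \<mu> x u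
      = reg (\<lambda>a. c x a \<mu> + \<beta> * (\<Sum>y\<in>UNIV. ?m y * pmf (p x a \<mu>) y)) u"
    unfolding S_def[symmetric] H1_def mean
    by (simp add: Cost_def reg_def distrib_right sum.distrib sum_distrib_left mult.assoc)
qed

lemma H1_reg: "H1 c p \<beta> \<rho> \<Omega> (\<lambda>x. reg (q x)) \<mu> = (\<lambda>x. reg (bellman q \<mu> x))"
  by (simp add: H1_eq_reg INF_reg bellman_def[abs_def])

lemma val_diff_le:
  assumes "lipschitz_cost l q" "0 \<le> l"
  shows "val (q y) - val (q y') \<le> l"
proof (rule val_mono_add)
  fix a
  have "\<bar>q y a - q y' a\<bar> \<le> l * of_bool (y \<noteq> y')"
    using assms(1)[unfolded lipschitz_cost_def, rule_format, of y a y' a] by simp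
  also have "\<dots> \<le> l" using assms(2) by simp
  finally show "q y a - q y' a \<le> l" by linarith
qed

text \<open>The continuation values oscillate by at most \<open>l\<close> over the states, so they
  contribute only \<open>l / 2\<close> times the distance of the kernels. A general \<open>l\<close>
  is kept because \<open>lipschitz_cost_fixed_point\<close> inserts the constant of the fixed point
  itself.\<close>

lemma bellman_lipschitz:
  assumes "lipschitz_cost l q" "0 \<le> l"
  shows "\<bar>bellman q \<mu> x a - bellman q \<nu> x' a'\<bar>
    \<le> (L1 + \<beta> * (l / 2 * K1)) * (of_bool (x \<noteq> x') + 2 * of_bool (a \<noteq> a') + l1_dist \<mu> \<nu>)"
proof -
  let ?d = "of_bool (x \<noteq> x') + 2 * of_bool (a \<noteq> a') + l1_dist \<mu> \<nu>"
  let ?S = "\<Sum>y\<in>UNIV. val (q y) * (pmf (p x a \<mu>) y - pmf (p x' a' \<nu>) y)"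
  have "\<bar>?S\<bar> \<le> l / 2 * l1_dist (p x a \<mu>) (p x' a' \<nu>)"
    using val_diff_le[OF assms] by (rule abs_sum_pmf_diff_le)
  also have "\<dots> \<le> l / 2 * (K1 * ?d)" using assms(2) by (intro mult_left_mono p_lipschitz) simp
  finally have S: "\<bar>\<beta> * ?S\<bar> \<le> \<beta> * (l / 2 * (K1 * ?d))"
    using beta by (simp add: abs_mult)
  have "bellman q \<mu> x a - bellman q \<nu> x' a' = (c x a \<mu> - c x' a' \<nu>) + \<beta> * ?S"
    by (simp add: bellman_def right_diff_distrib sum_subtractf)
  also have "\<bar>\<dots>\<bar> \<le> L1 * ?d + \<beta> * (l / 2 * (K1 * ?d))"
    using c_lipschitz S by (rule order_trans[OF abs_triangle_ineq add_mono])
  also have "\<dots> = (L1 + \<beta> * (l / 2 * K1)) * ?d" by (simp only: distrib_right mult.assoc)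
  finally show ?thesis .
qed

lemma lipschitz_cost_bellman:
  assumes "lipschitz_cost L q"
  shows "lipschitz_cost L (bellman q \<mu>)"
  using bellman_lipschitz[OF assms L_nonneg, of \<mu> _ _ \<mu>] unfolding L_fixed_point lipschitz_cost_def
  by simp

text \<open>Pass through \<open>bellman r \<mu>\<close>: exchanging the cost is discounted by
  \<open>\<beta>\<close>, and exchanging the measure then costs \<open>L\<close>, which is why the
  Lipschitz condition is put on \<open>r\<close>.\<close>

lemma bellman_diff_le:
  assumes "lipschitz_cost L r" and qr: "\<And>x a. \<bar>q x a - r x a\<bar> \<le> D"
  shows "\<bar>bellman q \<mu> x a - bellman r \<nu> x a\<bar> \<le> \<beta> * D + L * l1_dist \<mu> \<nu>"
proof -
  have v: "\<bar>val (q y) - val (r y)\<bar> \<le> D" for y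
    using qr[of y] by (intro abs_leI) (auto intro!: val_mono_add simp: abs_le_iff)
  have "bellman q \<mu> x a - bellman r \<mu> x a
      = \<beta> * (\<Sum>y\<in>UNIV. (val (q y) - val (r y)) * pmf (p x a \<mu>) y)"
    by (simp add: bellman_def left_diff_distrib right_diff_distrib sum_subtractf)
  also have "\<bar>\<dots>\<bar> \<le> \<beta> * D"
    using beta abs_expectation_pmf_le[OF v] by (simp add: abs_mult)
  finally have "\<bar>bellman q \<mu> x a - bellman r \<mu> x a\<bar> \<le> \<beta> * D" .
  moreover have "\<bar>bellman r \<mu> x a - bellman r \<nu> x a\<bar> \<le> L * l1_dist \<mu> \<nu>"
    using bellman_lipschitz[OF assms(1) L_nonneg, of \<mu> x a \<nu> x a] unfolding L_fixed_point by simp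
  ultimately show ?thesis by linarith
qed

text \<open>A fixed point is Lipschitz with its optimal constant \<open>l\<close>; the fixed point equation turns this into
  \<open>l \<le> L1 + \<beta> K1 l / 2\<close>. Division by zero makes the trivial pairs contribute 0 to the maximum.\<close>

lemma lipschitz_cost_fixed_point:
  assumes fixed: "q = bellman q \<mu>"
  shows "lipschitz_cost L q"
proof -
  define d :: "'x \<times> 'a \<Rightarrow> 'x \<times> 'a \<Rightarrow> real"
    where "d = (\<lambda>(x, a) (x', a'). of_bool (x \<noteq> x') + 2 * of_bool (a \<noteq> a'))"
  define h where "h = (\<lambda>(z, z'). \<bar>case_prod q z - case_prod q z'\<bar> / d z z')"
  define l where "l = Max (range h)"
  have d_nonneg: "0 \<le> d z z'" for z z' by (auto simp: d_def split: prod.split)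
  have d0: "d z z' = 0 \<longleftrightarrow> z = z'" for z z' by (auto simp: d_def split: prod.split)
  have h: "h (z, z') \<le> l" for z z' unfolding l_def by (rule Max_ge) auto
  have l0: "0 \<le> l" using h[of undefined undefined] by (simp add: h_def)
  have dist: "\<bar>case_prod q z - case_prod q z'\<bar> \<le> l * d z z'" for z z'
  proof (cases "z = z'")
    case True
    then show ?thesis by (simp add: l0 d_nonneg)
  next
    case False
    then have "0 < d z z'" using d0[of z z'] d_nonneg[of z z'] by linarith
    then show ?thesis using h[of z z'] by (simp add: h_def field_simps)
  qed
  have lip: "lipschitz_cost l q"
    unfolding lipschitz_cost_def
  proof (intro allI)
    fix x x' a a'
    show "\<bar>q x a - q x' a'\<bar> \<le> l * (of_bool (x \<noteq> x') + 2 * of_bool (a \<noteq> a'))"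
      using dist[of "(x, a)" "(x', a')"] by (simp add: d_def)
  qed
  have "l \<in> range h" unfolding l_def by (rule Max_in) auto
  then obtain z z' where zz': "l = h (z, z')" by auto
  have "l \<le> L"
  proof (cases "z = z'")
    case True
    then show ?thesis using L_nonneg by (simp add: zz' h_def)
  next
    case False
    then have pos: "0 < d z z'" using d0[of z z'] d_nonneg[of z z'] by linarith
    obtain x a x' a' where z: "z = (x, a)" "z' = (x', a')" by (cases z, cases z')
    have "\<bar>case_prod q z - case_prod q z'\<bar> \<le> (L1 + \<beta> * (l / 2 * K1)) * d z z'"
      using bellman_lipschitz[OF lip l0, of \<mu> x a \<mu> x' a']
      by (simp add: fixed[symmetric] d_def z)
    then have "h (z, z') \<le> L1 + \<beta> * (l / 2 * K1)"
      by (simp only: h_def case_prod_conv pos_divide_le_eq[OF pos])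
    then have "l \<le> L1 + \<beta> * (l / 2 * K1)" by (simp only: zz'[symmetric])
    then have "l * (1 - \<beta> * K1 / 2) \<le> L1" by (simp add: algebra_simps)
    then show ?thesis using beta_K1 by (simp add: Lbar_def pos_le_divide_eq)
  qed
  show ?thesis unfolding lipschitz_cost_def
  proof (intro allI)
    fix x x' a a'
    have "\<bar>q x a - q x' a'\<bar> \<le> l * (of_bool (x \<noteq> x') + 2 * of_bool (a \<noteq> a'))"
      using lip by (simp add: lipschitz_cost_def)
    also have "\<dots> \<le> L * (of_bool (x \<noteq> x') + 2 * of_bool (a \<noteq> a'))"
      using \<open>l \<le> L\<close> by (rule mult_right_mono) simp
    finally show "\<bar>q x a - q x' a'\<bar> \<le> L * (of_bool (x \<noteq> x') + 2 * of_bool (a \<noteq> a'))" .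
  qed
qed

section \<open>Stability of the state dynamics\<close>

text \<open>Change the action law first, then state and measure under a common action law. Different
  actions move the kernel by up to \<open>2 * K1\<close>, which the oscillation bound
  halves.\<close>

lemma Trans_lipschitz:
  "l1_dist (Trans p x u \<mu>) (Trans p x' v \<nu>) \<le> K1 * (of_bool (x \<noteq> x') + l1_dist u v + l1_dist \<mu> \<nu>)"
proof -
  have pa: "l1_dist (p x a \<mu>) (p x a' \<mu>) \<le> 2 * K1" for a a'
    using p_lipschitz[of x a \<mu> x a' \<mu>] K1_nonneg by (cases "a = a'") simp_all
  have "l1_dist (Trans p x u \<mu>) (Trans p x v \<mu>)
      = (\<Sum>y\<in>UNIV. \<bar>\<Sum>a\<in>UNIV. pmf (p x a \<mu>) y * (pmf u a - pmf v a)\<bar>)"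
    by (simp add: l1_dist_def pmf_Trans right_diff_distrib sum_subtractf)
  also have "\<dots> \<le> 2 * K1 / 2 * l1_dist u v"
    using pa unfolding l1_dist_def[of "p _ _ _"] by (rule l1_norm_mixture_diff_le)
  finally have 1: "l1_dist (Trans p x u \<mu>) (Trans p x v \<mu>) \<le> K1 * l1_dist u v" by simp
  have "l1_dist (Trans p x v \<mu>) (Trans p x' v \<nu>)
      = (\<Sum>y\<in>UNIV. \<bar>\<Sum>a\<in>UNIV. (pmf (p x a \<mu>) y - pmf (p x' a \<nu>) y) * pmf v a\<bar>)"
    by (simp add: l1_dist_def pmf_Trans left_diff_distrib sum_subtractf)
  also have "\<dots> \<le> K1 * (of_bool (x \<noteq> x') + l1_dist \<mu> \<nu>)"
  proof (rule l1_norm_mixture_le)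
    fix a
    show "(\<Sum>y\<in>UNIV. \<bar>pmf (p x a \<mu>) y - pmf (p x' a \<nu>) y\<bar>) \<le> K1 * (of_bool (x \<noteq> x') + l1_dist \<mu> \<nu>)"
      using p_lipschitz[of x a \<mu> x' a \<nu>] by (simp add: l1_dist_def[of "p _ _ _"])
  qed
  finally have 2: "l1_dist (Trans p x v \<mu>) (Trans p x' v \<nu>) \<le> K1 * (of_bool (x \<noteq> x') + l1_dist \<mu> \<nu>)" .
  show ?thesis
    using 1 2 l1_dist_triangle[of "Trans p x u \<mu>" "Trans p x' v \<nu>" "Trans p x v \<mu>"]
    by (simp add: distrib_left)
qed

text \<open>The difference splits into a change of kernels averaged under \<open>\<mu>\<close> and a
  change of the averaging measure for the kernels belonging to \<open>R\<close> and
  \<open>\<nu>\<close>.\<close>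

lemma H2_greedy_lipschitz:
  fixes Q R :: "'x \<Rightarrow> 'a pmf \<Rightarrow> real"
  assumes UV: "\<And>x. l1_dist (arg_min (Q x) (\<lambda>_. True)) (arg_min (R x) (\<lambda>_. True)) \<le> \<eta>"
  shows "l1_dist (H2 p (greedy_policy Q) \<mu>) (H2 p (greedy_policy R) \<nu>)
    \<le> KD K1 * l1_dist \<mu> \<nu> + K1 * \<eta>"
proof -
  let ?U = "\<lambda>x. arg_min (Q x) (\<lambda>_. True)" and ?V = "\<lambda>x. arg_min (R x) (\<lambda>_. True)"
  let ?F = "\<lambda>x y. pmf (Trans p x (?U x) \<mu>) y - pmf (Trans p x (?V x) \<nu>) y"
  let ?G = "\<lambda>x y. pmf (Trans p x (?V x) \<nu>) y"
  have "l1_dist (H2 p (greedy_policy Q) \<mu>) (H2 p (greedy_policy R) \<nu>)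
      = (\<Sum>y\<in>UNIV. \<bar>(\<Sum>x\<in>UNIV. ?F x y * pmf \<mu> x) + (\<Sum>x\<in>UNIV. ?G x y * (pmf \<mu> x - pmf \<nu> x))\<bar>)"
    by (simp add: l1_dist_def pmf_H2_greedy left_diff_distrib right_diff_distrib sum_subtractf)
  also have "\<dots> \<le> (\<Sum>y\<in>UNIV. \<bar>\<Sum>x\<in>UNIV. ?F x y * pmf \<mu> x\<bar>)
      + (\<Sum>y\<in>UNIV. \<bar>\<Sum>x\<in>UNIV. ?G x y * (pmf \<mu> x - pmf \<nu> x)\<bar>)"
    by (rule order_trans[OF sum_mono[OF abs_triangle_ineq] eq_refl[OF sum.distrib]])
  also have "\<dots> \<le> K1 * (\<eta> + l1_dist \<mu> \<nu>) + 2 * min 1 (3/2 * K1) / 2 * l1_dist \<mu> \<nu>"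
  proof (rule add_mono[OF l1_norm_mixture_le l1_norm_mixture_diff_le])
    fix x
    have "(\<Sum>y\<in>UNIV. \<bar>?F x y\<bar>) \<le> K1 * (l1_dist (?U x) (?V x) + l1_dist \<mu> \<nu>)"
      using Trans_lipschitz[of x "?U x" \<mu> x "?V x" \<nu>] by (simp add: l1_dist_def[of "Trans _ _ _ _"])
    also have "\<dots> \<le> K1 * (\<eta> + l1_dist \<mu> \<nu>)"
      using UV K1_nonneg by (intro mult_left_mono) auto
    finally show "(\<Sum>y\<in>UNIV. \<bar>?F x y\<bar>) \<le> K1 * (\<eta> + l1_dist \<mu> \<nu>)" .
    fix x'
    \<comment> \<open>The action laws at two states are only known to be within 2 of each other,
      which gives \<open>3 * K1\<close>; any two laws are within 2. Halving both bounds produces the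
      minimum in \<open>KD\<close>.\<close>
    have "l1_dist (Trans p x (?V x) \<nu>) (Trans p x' (?V x') \<nu>) \<le> K1 * (1 + 2 + 0)"
      using K1_nonneg by (intro order_trans[OF Trans_lipschitz] mult_left_mono add_mono l1_dist_le_2) auto
    then show "(\<Sum>y\<in>UNIV. \<bar>?G x y - ?G x' y\<bar>) \<le> 2 * min 1 (3/2 * K1)"
      using l1_dist_le_2[of "Trans p x (?V x) \<nu>" "Trans p x' (?V x') \<nu>"]
      by (simp add: l1_dist_def[of "Trans _ _ _ _"] min_def)
  qed
  also have "\<dots> = KD K1 * l1_dist \<mu> \<nu> + K1 * \<eta>" by (simp add: KD_def algebra_simps)
  finally show ?thesis .
qed

end

section \<open>Contraction of backward sweeps\<close>

locale contraction_model = regularized_model c p \<Omega> \<beta> \<rho> L1 K1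
  for c :: "'x::finite \<Rightarrow> 'a::finite \<Rightarrow> 'x pmf \<Rightarrow> real"
    and p :: "'x \<Rightarrow> 'a \<Rightarrow> 'x pmf \<Rightarrow> 'x pmf"
    and \<Omega> :: "'a pmf \<Rightarrow> real"
    and \<beta> \<rho> L1 K1 :: real +
  fixes y :: real and T :: nat and \<mu>init :: "'x pmf"
  assumes y_ge_1: "1 \<le> y" and y_gt_KD: "KD K1 < y"
    and rate: "\<beta> * y + Lbar \<beta> L1 K1 * K1 / \<rho> / (y - KD K1) < 1"
begin

definition \<kappa> :: real where
  "\<kappa> = \<beta> * y + L * K1 / \<rho> / (y - KD K1)"

definition Qfam :: "(nat \<Rightarrow> 'x \<Rightarrow> 'a \<Rightarrow> real) \<Rightarrow> nat \<Rightarrow> 'x \<Rightarrow> 'a pmf \<Rightarrow> real" where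
  "Qfam q = (\<lambda>t\<in>{..T}. \<lambda>x. reg (q t x))"

text \<open>The sign and size conditions of \<open>C_tilde\<close> are left out: since \<open>\<Omega>\<close> may have any sign, \<open>Phi\<close> need not
  preserve them, and only the Lipschitz condition enters the estimates.\<close>

definition lipschitz_fam :: "(nat \<Rightarrow> 'x \<Rightarrow> 'a \<Rightarrow> real) \<Rightarrow> bool" where
  "lipschitz_fam q \<longleftrightarrow> (\<forall>t\<le>T. lipschitz_cost L (q t))"

text \<open>The weights \<open>y ^ t\<close> make \<open>D\<close> a bound for the distance of the Q-functions in the norm \<open>Q_sup\<close> below.\<close>

definition close :: "(nat \<Rightarrow> 'x \<Rightarrow> 'a \<Rightarrow> real) \<Rightarrow> (nat \<Rightarrow> 'x \<Rightarrow> 'a \<Rightarrow> real) \<Rightarrow> real \<Rightarrow> bool" where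
  "close q r D \<longleftrightarrow> (\<forall>t\<le>T. \<forall>x a. \<bar>q t x a - r t x a\<bar> \<le> D / y ^ t)"

abbreviation flw :: "(nat \<Rightarrow> 'x \<Rightarrow> 'a \<Rightarrow> real) \<Rightarrow> nat \<Rightarrow> 'x pmf" where
  "flw q \<equiv> flow p T \<mu>init (Qfam q)"

text \<open>Truncated subtraction covers the two cases in the definition of \<open>Phi\<close> at once.\<close>

definition sweep :: "(nat \<Rightarrow> 'x \<Rightarrow> 'a \<Rightarrow> real) \<Rightarrow> nat \<Rightarrow> 'x \<Rightarrow> 'a \<Rightarrow> real" where
  "sweep q t = bellman (q (t - 1)) (flw q t)"

lemma Phi_Qfam: "Phi c p \<beta> \<rho> \<Omega> T \<mu>init (Qfam q) = Qfam (sweep q)"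
proof
  fix t
  show "Phi c p \<beta> \<rho> \<Omega> T \<mu>init (Qfam q) t = Qfam (sweep q) t"
  proof (cases "t \<le> T")
    case True
    then have "Qfam q (t - 1) = (\<lambda>x. reg (q (t - 1) x))" "Qfam q 0 = (\<lambda>x. reg (q 0 x))"
      by (auto simp: Qfam_def)
    then show ?thesis using True
      by (cases "t = 0") (simp_all add: Phi_def H1_reg sweep_def Qfam_def[of "sweep q"])
  qed (simp add: Phi_def Qfam_def)
qed

lemma y_pos: "0 < y" using y_ge_1 by simp

lemma kappa: "0 \<le> \<kappa>" "\<kappa> < 1"
  using rate beta rho y_pos y_gt_KD L_nonneg K1_nonneg by (simp_all add: \<kappa>_def)

lemma lipschitz_fam_sweep: "lipschitz_fam q \<Longrightarrow> lipschitz_fam (sweep q)"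
  by (simp add: lipschitz_fam_def sweep_def lipschitz_cost_bellman)

lemma closeD: "close q r D \<Longrightarrow> t \<le> T \<Longrightarrow> \<bar>q t x a - r t x a\<bar> \<le> D / y ^ t"
  by (simp add: close_def)

lemma close_nonneg:
  assumes "close q r D"
  shows "0 \<le> D"
  using order_trans[OF abs_ge_zero closeD[OF assms, of 0]] by simp

lemma close_trans:
  assumes "close q r D" "close r s E"
  shows "close q s (D + E)"
  unfolding close_def add_divide_distrib
proof (intro allI impI)
  fix t x a assume "t \<le> T"
  then show "\<bar>q t x a - s t x a\<bar> \<le> D / y ^ t + E / y ^ t"
    using closeD[OF assms(1), of t x a] closeD[OF assms(2), of t x a] by linarith
qed

lemma close_sym: "close q r D \<Longrightarrow> close r q D"
  by (simp add: close_def abs_minus_commute)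

text \<open>Only finitely many coefficients are compared, so a weighted maximum serves. It starts
  the geometric iterations below.\<close>

lemma close_ex: "\<exists>D. close q r D"
proof -
  let ?S = "(\<lambda>(t, x, a). y ^ t * \<bar>q t x a - r t x a\<bar>) ` ({..T} \<times> UNIV)"
  have "y ^ t * \<bar>q t x a - r t x a\<bar> \<le> Max ?S" if "t \<le> T" for t x a
    using that by (intro Max_ge) (auto intro!: image_eqI[where x = "(t, x, a)"])
  then show ?thesis
    unfolding close_def using y_pos by (intro exI[of _ "Max ?S"]) (simp add: pos_le_divide_eq mult.commute)
qed

text \<open>Both flows start from \<open>\<mu>init\<close> at index \<open>T\<close>, and the
  induction runs forward in time, that is, downward in the index.\<close>

lemma flow_close:
  assumes qr: "close q r D" and "t \<le> T"
  shows "l1_dist (flw q t) (flw r t) \<le> K1 / \<rho> * D / (y - KD K1) / y ^ t"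
  using \<open>t \<le> T\<close>
proof (induction rule: inc_induct)
  case base
  then show ?case
    using close_nonneg[OF qr] K1_nonneg rho y_gt_KD y_pos by (simp add: flow_start)
next
  case (step t)
  let ?B = "K1 / \<rho> * D / (y - KD K1)"
  have "l1_dist (opt (q (Suc t) x)) (opt (r (Suc t) x)) \<le> D / y ^ Suc t / \<rho>" for x
    using step.hyps by (intro opt_lipschitz closeD[OF qr]) simp
  then have "l1_dist (flw q t) (flw r t)
      \<le> KD K1 * l1_dist (flw q (Suc t)) (flw r (Suc t)) + K1 * (D / y ^ Suc t / \<rho>)"
    unfolding flow_step[OF step.hyps(2)] using step.hyps(2)
    by (intro H2_greedy_lipschitz) (simp add: Qfam_def opt_def)
  also have "\<dots> \<le> KD K1 * (?B / y ^ Suc t) + K1 * (D / y ^ Suc t / \<rho>)"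
    using step.IH K1_nonneg by (intro add_right_mono mult_left_mono) (auto simp: KD_def)
  \<comment> \<open>\<open>?B\<close> is the solution of
    \<open>KD K1 * ?B + K1 * D / \<rho> = y * ?B\<close>, so one time step uses up exactly one
    factor \<open>y\<close>.\<close>
  also have "\<dots> = ?B / y ^ t"
    using y_pos y_gt_KD rho by (simp add: field_simps)
  finally show ?case .
qed

text \<open>The old cost enters with index \<open>t - 1\<close>, which accounts for
  \<open>\<beta> * y\<close>; the flow error at index \<open>t\<close> accounts for the other term
  of \<open>\<kappa>\<close>.\<close>

lemma sweep_contraction:
  assumes r: "lipschitz_fam r" and qr: "close q r D"
  shows "close (sweep q) (sweep r) (\<kappa> * D)"
  unfolding close_def
proof (intro allI impI)
  fix t x a assume t: "t \<le> T"
  have D: "0 \<le> D" using qr by (rule close_nonneg)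
  \<comment> \<open>For positive \<open>t\<close> the shift of the index costs one factor
    \<open>y\<close>. Component 0 is updated from itself, without a shift, and
    \<open>y \<ge> 1\<close> lets it obey the same bound.\<close>
  have prev: "\<bar>q (t - 1) x a - r (t - 1) x a\<bar> \<le> D * y / y ^ t" for x a
  proof (cases t)
    case 0
    have "\<bar>q 0 x a - r 0 x a\<bar> \<le> D" using closeD[OF qr, of 0] by simp
    also have "\<dots> \<le> D * y" using D y_ge_1 by (simp add: mult_le_cancel_left1)
    finally show ?thesis by (simp add: 0)
  next
    case (Suc s)
    then have "\<bar>q s x a - r s x a\<bar> \<le> D / y ^ s" using closeD[OF qr] t by simp
    then show ?thesis using y_pos by (simp add: Suc)
  qed
  have "\<bar>sweep q t x a - sweep r t x a\<bar> \<le> \<beta> * (D * y / y ^ t) + L * l1_dist (flw q t) (flw r t)"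
    unfolding sweep_def using r t prev by (intro bellman_diff_le) (auto simp: lipschitz_fam_def)
  also have "\<dots> \<le> \<beta> * (D * y / y ^ t) + L * (K1 / \<rho> * D / (y - KD K1) / y ^ t)"
    using flow_close[OF qr t] L_nonneg by (intro add_left_mono mult_left_mono)
  also have "\<dots> = \<kappa> * D / y ^ t" by (simp add: \<kappa>_def add_divide_distrib distrib_left distrib_right mult_ac)
  finally show "\<bar>sweep q t x a - sweep r t x a\<bar> \<le> \<kappa> * D / y ^ t" .
qed

text \<open>The Lipschitz inequalities survive pointwise limits. The limit can therefore be the
  Lipschitz argument in later contraction estimates.\<close>

lemma lipschitz_fam_limit:
  assumes "\<And>n. lipschitz_fam (s n)" and "\<And>n. close q (s n) (\<kappa> ^ n * E)"
  shows "lipschitz_fam q"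
  unfolding lipschitz_fam_def lipschitz_cost_def
proof (intro allI impI)
  fix t x x' a a' assume t: "t \<le> T"
  have lim: "(\<lambda>n. s n t x a) \<longlonglongrightarrow> q t x a" for x a
  proof (rule LIM_zero_cancel, rule Lim_null_comparison)
    show "\<forall>\<^sub>F n in sequentially. norm (s n t x a - q t x a) \<le> \<kappa> ^ n * (E / y ^ t)"
      using assms(2) t by (simp add: close_def abs_minus_commute)
    show "(\<lambda>n. \<kappa> ^ n * (E / y ^ t)) \<longlonglongrightarrow> 0"
      using kappa by (intro tendsto_mult_left_zero LIMSEQ_realpow_zero) auto
  qed
  show "\<bar>q t x a - q t x' a'\<bar> \<le> L * (of_bool (x \<noteq> x') + 2 * of_bool (a \<noteq> a'))"
  proof (rule LIMSEQ_le_const2)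
    show "(\<lambda>n. \<bar>s n t x a - s n t x' a'\<bar>) \<longlonglongrightarrow> \<bar>q t x a - q t x' a'\<bar>"
      by (intro tendsto_intros lim)
    show "\<exists>N. \<forall>n\<ge>N. \<bar>s n t x a - s n t x' a'\<bar> \<le> L * (of_bool (x \<noteq> x') + 2 * of_bool (a \<noteq> a'))"
      using assms(1) t by (auto simp: lipschitz_fam_def lipschitz_cost_def)
  qed
qed

lemma close_powers_imp_eq:
  assumes "\<And>n. close q r (\<kappa> ^ n * E)" "t \<le> T"
  shows "q t = r t"
proof (intro ext)
  fix x a
  have "(\<lambda>n. \<kappa> ^ n * (E / y ^ t)) \<longlonglongrightarrow> 0"
    using kappa by (intro tendsto_mult_left_zero LIMSEQ_realpow_zero) auto
  then have "\<bar>q t x a - r t x a\<bar> \<le> 0"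
    by (rule LIMSEQ_le_const) (use assms in \<open>auto simp: close_def\<close>)
  then show "q t x a = r t x a" by simp
qed

lemma sweep_fixed_point_unique:
  assumes "lipschitz_fam q" "lipschitz_fam r"
    and "\<And>t. t \<le> T \<Longrightarrow> sweep q t = q t" "\<And>t. t \<le> T \<Longrightarrow> sweep r t = r t"
    and "t \<le> T"
  shows "q t = r t"
proof -
  obtain D where D: "close q r D" using close_ex by blast
  have "close q r (\<kappa> ^ n * D)" for n
  proof (induction n)
    case 0
    then show ?case using D by simp
  next
    case (Suc n)
    then show ?case using sweep_contraction[OF assms(2) Suc] assms(3,4) by (simp add: close_def mult.assoc)
  qed
  then show ?thesis using \<open>t \<le> T\<close> by (rule close_powers_imp_eq)
qed

text \<open>Picard iteration from the zero cost, with the limit taken coefficient by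
  coefficient.\<close>

lemma sweep_fixed_point_ex:
  obtains q where "lipschitz_fam q" "\<And>t. t \<le> T \<Longrightarrow> sweep q t = q t"
proof -
  define s where "s n = (sweep ^^ n) (\<lambda>_ _ _. 0)" for n
  have lip: "lipschitz_fam (s n)" for n
    by (induction n) (auto simp: s_def lipschitz_fam_sweep, simp add: lipschitz_fam_def lipschitz_cost_def L_nonneg)
  obtain D where D: "close (s 1) (s 0) D" using close_ex by blast
  have inc: "close (s (Suc n)) (s n) (\<kappa> ^ n * D)" for n
  proof (induction n)
    case 0
    then show ?case using D by simp
  next
    case (Suc n)
    then show ?case using sweep_contraction[OF lip Suc] by (simp add: s_def mult.assoc)
  qed
  define E where "E = D / (1 - \<kappa>)"
  have "\<exists>l. \<forall>n. \<bar>l - s n t x a\<bar> \<le> \<kappa> ^ n * (D / y ^ t / (1 - \<kappa>))" if "t \<le> T" for t x a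
    using inc that kappa by (intro geometric_increments_limit) (auto simp: close_def)
  then obtain q where q: "\<And>t x a n. t \<le> T \<Longrightarrow> \<bar>q t x a - s n t x a\<bar> \<le> \<kappa> ^ n * (D / y ^ t / (1 - \<kappa>))"
    by metis
  have qs: "close q (s n) (\<kappa> ^ n * E)" for n
    using q by (simp add: close_def E_def mult_ac)
  have ql: "lipschitz_fam q" using lip qs by (rule lipschitz_fam_limit)
  \<comment> \<open>Both \<open>sweep q\<close> and \<open>q\<close> are within
    \<open>\<kappa> ^ Suc n * E\<close> of the iterate \<open>s (Suc n)\<close>.\<close>
  have "close (sweep q) q (\<kappa> ^ n * (2 * \<kappa> * E))" for n
    using close_trans[OF sweep_contraction[OF lip qs[of n]], of q "\<kappa> ^ Suc n * E"] close_sym[OF qs[of "Suc n"]]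
    by (simp add: s_def algebra_simps)
  then have "sweep q t = q t" if "t \<le> T" for t using that by (rule close_powers_imp_eq)
  with ql show ?thesis by (rule that)
qed

section \<open>The weighted supremum norm and the contraction of \<open>Phi\<close>\<close>

definition Q_sup :: "(nat \<Rightarrow> 'x \<Rightarrow> 'a pmf \<Rightarrow> real) \<Rightarrow> real" where
  "Q_sup Q = (SUP (t, x, u)\<in>{..T} \<times> UNIV. y ^ t * \<bar>Q t x u\<bar>)"

lemma Q_sup_leI:
  assumes "\<And>t x u. t \<le> T \<Longrightarrow> y ^ t * \<bar>Q t x u\<bar> \<le> D"
  shows "Q_sup Q \<le> D"
  unfolding Q_sup_def by (rule cSUP_least) (use assms in auto)

lemma Q_sup_upper:
  assumes "Q \<in> bounded_Q_families T" "t \<le> T"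
  shows "y ^ t * \<bar>Q t x u\<bar> \<le> Q_sup Q"
proof -
  have "\<exists>B. \<forall>x u. \<bar>Q t x u\<bar> \<le> B" if "t \<le> T" for t
    using assms(1) that by (fastforce simp: bounded_Q_families_def bounded_iff PiE_iff)
  then obtain B where B: "\<And>t x u. t \<le> T \<Longrightarrow> \<bar>Q t x u\<bar> \<le> B t" by metis
  have "bdd_above ((\<lambda>(t, x, u). y ^ t * \<bar>Q t x u\<bar>) ` ({..T} \<times> UNIV))"
  proof (rule bdd_aboveI2)
    fix z :: "nat \<times> 'x \<times> 'a pmf" assume "z \<in> {..T} \<times> UNIV"
    moreover obtain s x u where z: "z = (s, x, u)" by (cases z)
    ultimately have s: "s \<in> {..T}" by simp
    have "y ^ s * \<bar>Q s x u\<bar> \<le> y ^ s * \<bar>B s\<bar>"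
      using B[of s x u] s y_pos by (intro mult_left_mono) auto
    also have "\<dots> \<le> (\<Sum>t\<le>T. y ^ t * \<bar>B t\<bar>)"
      using s y_pos by (intro member_le_sum) auto
    finally show "(case z of (t, x, u) \<Rightarrow> y ^ t * \<bar>Q t x u\<bar>) \<le> (\<Sum>t\<le>T. y ^ t * \<bar>B t\<bar>)" by (simp add: z)
  qed
  from cSUP_upper[OF _ this, of "(t, x, u)"] show ?thesis using assms(2) by (simp add: Q_sup_def)
qed

lemma Q_norm_Q_sup: "Q_norm T Q_sup"
  unfolding Q_norm_def
proof (intro conjI ballI allI)
  fix Q :: "nat \<Rightarrow> 'x \<Rightarrow> 'a pmf \<Rightarrow> real" assume Q: "Q \<in> bounded_Q_families T"
  show nn: "0 \<le> Q_sup Q"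
    by (rule order_trans[OF _ Q_sup_upper[OF Q, of 0 undefined undefined]]) auto
  show "Q_sup Q = 0 \<longleftrightarrow> (\<forall>t\<le>T. \<forall>x u. Q t x u = 0)"
  proof
    assume 0: "Q_sup Q = 0"
    show "\<forall>t\<le>T. \<forall>x u. Q t x u = 0"
    proof (intro allI impI)
      fix t x u assume "t \<le> T"
      then have "y ^ t * \<bar>Q t x u\<bar> \<le> 0" using Q_sup_upper[OF Q] 0 by metis
      then show "Q t x u = 0" using zero_less_power[OF y_pos, of t] by (auto simp: mult_le_0_iff)
    qed
  next
    assume "\<forall>t\<le>T. \<forall>x u. Q t x u = 0"
    then have "Q_sup Q \<le> 0" by (intro Q_sup_leI) simp
    with nn show "Q_sup Q = 0" by simp
  qed
  fix r :: real
  have scale: "Q_sup (\<lambda>t\<in>{..T}. \<lambda>x u. r * Q t x u) \<le> \<bar>r\<bar> * Q_sup Q"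
    if Q: "Q \<in> bounded_Q_families T" for Q and r :: real
  proof (rule Q_sup_leI)
    fix t x u assume "t \<le> T"
    then show "y ^ t * \<bar>(\<lambda>t\<in>{..T}. \<lambda>x u. r * Q t x u) t x u\<bar> \<le> \<bar>r\<bar> * Q_sup Q"
      using mult_left_mono[OF Q_sup_upper[OF Q, of t x u], of "\<bar>r\<bar>"] by (simp add: abs_mult mult_ac)
  qed
  show "Q_sup (\<lambda>t\<in>{..T}. \<lambda>x u. r * Q t x u) = \<bar>r\<bar> * Q_sup Q" (is "Q_sup ?rQ = _")
  proof (rule antisym[OF scale[OF Q]])
    have rQ: "?rQ \<in> bounded_Q_families T"
    proof -
      have "bounded (range (\<lambda>(x, u). r * Q t x u))" if "t \<le> T" for t
      proof -
        have "bounded (range (\<lambda>(x, u). Q t x u))" using Q that by (auto simp: bounded_Q_families_def)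
        then have "bounded ((*) r ` range (\<lambda>(x, u). Q t x u))"
          by (rule bounded_linear_image) (rule bounded_linear_mult_right)
        then show ?thesis by (simp add: image_image case_prod_beta)
      qed
      then show ?thesis by (auto simp: bounded_Q_families_def)
    qed
    show "\<bar>r\<bar> * Q_sup Q \<le> Q_sup ?rQ"
    proof (cases "r = 0")
      case True
      have "0 \<le> Q_sup ?rQ"
        by (rule order_trans[OF _ Q_sup_upper[OF rQ, of 0 undefined undefined]]) auto
      then show ?thesis using True by simp
    next
      case False
      have "Q_sup Q \<le> Q_sup ?rQ / \<bar>r\<bar>"
      proof (rule Q_sup_leI)
        fix t x u assume "t \<le> T"
        then show "y ^ t * \<bar>Q t x u\<bar> \<le> Q_sup ?rQ / \<bar>r\<bar>"
          using Q_sup_upper[OF rQ, of t x u] False by (simp add: pos_le_divide_eq abs_mult mult_ac)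
      qed
      then show ?thesis using False by (simp add: pos_le_divide_eq mult.commute)
    qed
  qed
next
  fix Q R :: "nat \<Rightarrow> 'x \<Rightarrow> 'a pmf \<Rightarrow> real"
  assume Q: "Q \<in> bounded_Q_families T" and R: "R \<in> bounded_Q_families T"
  show "Q_sup (\<lambda>t\<in>{..T}. \<lambda>x u. Q t x u + R t x u) \<le> Q_sup Q + Q_sup R"
  proof (rule Q_sup_leI)
    fix t x u assume t: "t \<le> T"
    have "y ^ t * \<bar>Q t x u + R t x u\<bar> \<le> y ^ t * (\<bar>Q t x u\<bar> + \<bar>R t x u\<bar>)"
      using y_pos by (intro mult_left_mono abs_triangle_ineq) simp
    also have "\<dots> \<le> Q_sup Q + Q_sup R"
      using Q_sup_upper[OF Q t] Q_sup_upper[OF R t] by (simp add: distrib_left add_mono)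
    finally show "y ^ t * \<bar>(\<lambda>t\<in>{..T}. \<lambda>x u. Q t x u + R t x u) t x u\<bar> \<le> Q_sup Q + Q_sup R"
      using t by simp
  qed
qed

lemma Qfam_bounded: "Qfam q \<in> bounded_Q_families T"
proof -
  have "\<forall>t x. \<exists>B. \<forall>u. \<bar>reg (q t x) u\<bar> \<le> B" using reg_bounded by blast
  then obtain B where B: "\<And>t x u. \<bar>reg (q t x) u\<bar> \<le> B t x" by metis
  have "bounded (range (\<lambda>(x, u). reg (q t x) u))" for t
  proof (rule boundedI)
    fix z assume "z \<in> range (\<lambda>(x, u). reg (q t x) u)"
    then obtain x u where z: "z = reg (q t x) u" by auto
    have "\<bar>z\<bar> \<le> B t x" using B by (simp add: z)
    also have "\<dots> \<le> Max (range (B t))" by simp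
    finally show "norm z \<le> Max (range (B t))" by simp
  qed
  then show ?thesis by (auto simp: bounded_Q_families_def Qfam_def)
qed

text \<open>The regularizer cancels in the difference, which leaves averages of finitely many
  coefficients.\<close>

lemma Q_diff_Qfam_bounded: "Q_diff T (Qfam q) (Qfam r) \<in> bounded_Q_families T"
proof -
  have "bounded (range (\<lambda>(x, u). reg (q t x) u - reg (r t x) u))" for t
  proof (rule boundedI)
    fix z assume "z \<in> range (\<lambda>(x, u). reg (q t x) u - reg (r t x) u)"
    then obtain x u where z: "z = (\<Sum>a\<in>UNIV. (q t x a - r t x a) * pmf u a)" by (auto simp: reg_diff)
    show "norm z \<le> Max (range (\<lambda>(x, a). \<bar>q t x a - r t x a\<bar>))"
      unfolding z real_norm_def
      by (intro abs_expectation_pmf_le Max_ge) (auto intro!: image_eqI[where x = "(x, _)"])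
  qed
  then show ?thesis by (auto simp: bounded_Q_families_def Q_diff_def Qfam_def)
qed

text \<open>Point masses give one direction and averaging the other, so the norm distance of two
  families is the weighted distance of their coefficients.\<close>

lemma Q_sup_diff_le_iff: "Q_sup (Q_diff T (Qfam q) (Qfam r)) \<le> D \<longleftrightarrow> close q r D"
proof
  assume le: "Q_sup (Q_diff T (Qfam q) (Qfam r)) \<le> D"
  show "close q r D" unfolding close_def
  proof (intro allI impI)
    fix t x a assume t: "t \<le> T"
    have "y ^ t * \<bar>q t x a - r t x a\<bar> \<le> D"
      using order_trans[OF Q_sup_upper[OF Q_diff_Qfam_bounded t, where x = x and u = "return_pmf a"] le] t
      by (simp add: Q_diff_def Qfam_def reg_diff expectation_return_pmf)
    then show "\<bar>q t x a - r t x a\<bar> \<le> D / y ^ t" using y_pos by (simp add: pos_le_divide_eq mult.commute)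
  qed
next
  assume "close q r D"
  then have "\<bar>\<Sum>a\<in>UNIV. (q t x a - r t x a) * pmf u a\<bar> \<le> D / y ^ t" if "t \<le> T" for t x u
    using that by (intro abs_expectation_pmf_le) (simp add: close_def)
  then show "Q_sup (Q_diff T (Qfam q) (Qfam r)) \<le> D"
    using y_pos by (intro Q_sup_leI) (simp add: Q_diff_def Qfam_def reg_diff pos_le_divide_eq mult.commute)
qed

lemma Phi_contraction:
  assumes "lipschitz_fam r"
  shows "Q_sup (Q_diff T (Phi c p \<beta> \<rho> \<Omega> T \<mu>init (Qfam q)) (Phi c p \<beta> \<rho> \<Omega> T \<mu>init (Qfam r)))
    \<le> \<kappa> * Q_sup (Q_diff T (Qfam q) (Qfam r))"
proof -
  have "close q r (Q_sup (Q_diff T (Qfam q) (Qfam r)))" by (simp add: Q_sup_diff_le_iff[symmetric])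
  from sweep_contraction[OF assms this] show ?thesis by (simp add: Phi_Qfam Q_sup_diff_le_iff)
qed

lemma C_beta_fam:
  assumes "Q \<in> {..T} \<rightarrow>\<^sub>E C_beta c \<beta> \<rho> \<Omega> L1 K1"
  obtains q where "lipschitz_fam q" "Q = Qfam q"
proof -
  have "\<exists>f. lipschitz_cost L f \<and> Q t = (\<lambda>x. reg (f x))" if "t \<le> T" for t
  proof -
    have "Q t \<in> C_beta c \<beta> \<rho> \<Omega> L1 K1" using assms that by auto
    then obtain f where "f \<in> C_tilde c \<beta> L1 K1" "Q t = (\<lambda>x. reg (f x))"
      by (auto simp: C_beta_def reg_def[abs_def])
    moreover from this(1) have "lipschitz_cost L f" by (simp add: C_tilde_def lipschitz_cost_def)
    ultimately show ?thesis by blast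
  qed
  then obtain q where q: "\<And>t. t \<le> T \<Longrightarrow> lipschitz_cost L (q t) \<and> Q t = (\<lambda>x. reg (q t x))"
    by metis
  have "Q = Qfam q"
  proof
    fix t show "Q t = Qfam q t" using assms q by (cases "t \<le> T") (auto simp: Qfam_def)
  qed
  moreover have "lipschitz_fam q" using q by (simp add: lipschitz_fam_def)
  ultimately show ?thesis using that by blast
qed

text \<open>Every step shrinks the distance to the fixed point by \<open>\<kappa>\<close>, the fixed
  point being the Lipschitz argument of \<open>Phi_contraction\<close>.\<close>

lemma Phi_iterates_converge:
  assumes "lipschitz_fam q" and fixed: "Phi c p \<beta> \<rho> \<Omega> T \<mu>init (Qfam q) = Qfam q"
  shows "(\<lambda>n. Q_sup (Q_diff T ((Phi c p \<beta> \<rho> \<Omega> T \<mu>init ^^ n) (Qfam r)) (Qfam q))) \<longlonglongrightarrow> 0"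
proof (rule Lim_null_comparison)
  let ?P = "Phi c p \<beta> \<rho> \<Omega> T \<mu>init" and ?D = "Q_sup (Q_diff T (Qfam r) (Qfam q))"
  have iter: "(?P ^^ n) (Qfam r) = Qfam ((sweep ^^ n) r)" for n
    by (induction n) (simp_all add: Phi_Qfam)
  have le: "Q_sup (Q_diff T ((?P ^^ n) (Qfam r)) (Qfam q)) \<le> \<kappa> ^ n * ?D" for n
  proof (induction n)
    case (Suc n)
    have "Q_sup (Q_diff T ((?P ^^ Suc n) (Qfam r)) (Qfam q))
        \<le> \<kappa> * Q_sup (Q_diff T ((?P ^^ n) (Qfam r)) (Qfam q))"
      using Phi_contraction[OF assms(1), of "(sweep ^^ n) r"] by (simp add: iter fixed)
    also have "\<dots> \<le> \<kappa> * (\<kappa> ^ n * ?D)" using Suc kappa by (intro mult_left_mono)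
    finally show ?case by (simp add: mult.assoc)
  qed simp
  have "0 \<le> Q_sup (Q_diff T ((?P ^^ n) (Qfam r)) (Qfam q))" for n
    using Q_norm_Q_sup Q_diff_Qfam_bounded unfolding iter by (simp add: Q_norm_def)
  then show "\<forall>\<^sub>F n in sequentially. norm (Q_sup (Q_diff T ((?P ^^ n) (Qfam r)) (Qfam q))) \<le> \<kappa> ^ n * ?D"
    using le by simp
  show "(\<lambda>n. \<kappa> ^ n * ?D) \<longlonglongrightarrow> 0"
    using kappa by (intro tendsto_mult_left_zero LIMSEQ_realpow_zero) auto
qed

section \<open>Equilibria as fixed points\<close>

text \<open>The set of minimizers has one element, so the support condition determines the whole
  measure.\<close>

lemma AE_arg_min_iff_greedy:
  assumes "\<pi> \<in> policies" "Q x = reg f"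
  shows "(AE u in \<pi> x. is_arg_min (Q x) (\<lambda>_. True) u) \<longleftrightarrow> \<pi> x = greedy_policy Q x"
proof
  assume ae: "AE u in \<pi> x. is_arg_min (Q x) (\<lambda>_. True) u"
  have "prob_space (\<pi> x)" "sets (\<pi> x) = sets pmf_borel"
    using assms(1) by (auto simp: policies_def space_prob_algebra)
  moreover have "AE u in \<pi> x. u = opt f" using ae by (simp add: assms(2) is_arg_min_reg_iff)
  ultimately show "\<pi> x = greedy_policy Q x"
    unfolding greedy_policy_def assms(2) opt_def[symmetric] by (rule prob_space_eq_return)
next
  assume "\<pi> x = greedy_policy Q x"
  then show "AE u in \<pi> x. is_arg_min (Q x) (\<lambda>_. True) u"
    using AE_greedy_policy[of Q x] by (simp only: assms(2) is_arg_min_reg_iff opt_def)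
qed

definition greedy_mfe :: "(nat \<Rightarrow> 'x \<Rightarrow> 'a \<Rightarrow> real)
    \<Rightarrow> (nat \<Rightarrow> 'x \<Rightarrow> 'a pmf measure) \<times> (nat \<Rightarrow> 'x pmf)" where
  "greedy_mfe q = (\<lambda>t\<in>{..T}. greedy_policy (Qfam q t), \<lambda>t\<in>{..T}. flw q t)"

lemma MFE_of_fixed_point:
  assumes fixed: "\<And>t. t \<le> T \<Longrightarrow> sweep q t = q t"
  shows "greedy_mfe q \<in> MFE c p \<beta> \<rho> \<Omega> T \<mu>init (Qfam q 0)"
    and "Qfam q 0 = H1 c p \<beta> \<rho> \<Omega> (Qfam q 0) (flw q 0)"
proof -
  have H1: "Qfam q t = H1 c p \<beta> \<rho> \<Omega> (Qfam q (t - 1)) (flw q t)" if "t \<le> T" for t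
  proof -
    have "Qfam q t = (\<lambda>x. reg (sweep q t x))" using that fixed by (simp add: Qfam_def)
    also have "\<dots> = H1 c p \<beta> \<rho> \<Omega> (\<lambda>x. reg (q (t - 1) x)) (flw q t)"
      by (simp only: H1_reg sweep_def)
    also have "(\<lambda>x. reg (q (t - 1) x)) = Qfam q (t - 1)"
      using that diff_le_self[of t 1] by (simp add: Qfam_def del: diff_le_self)
    finally show ?thesis .
  qed
  \<comment> \<open>Since \<open>0 - 1 = 0\<close> for natural numbers, the instance
    \<open>t = 0\<close> is the stationarity of the terminal Q-function.\<close>
  then show "Qfam q 0 = H1 c p \<beta> \<rho> \<Omega> (Qfam q 0) (flw q 0)" by (metis diff_0_eq_0 le0)
  have greedy: "AE u in (\<lambda>t\<in>{..T}. greedy_policy (Qfam q t)) t x. is_arg_min (Qfam q t x) (\<lambda>_. True) u"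
    if t: "t \<le> T" for t x
  proof -
    have Qt: "Qfam q t x = reg (q t x)" using t by (simp add: Qfam_def)
    have "(\<lambda>t\<in>{..T}. greedy_policy (Qfam q t)) t = greedy_policy (Qfam q t)" using t by simp
    then show ?thesis
      using AE_arg_min_iff_greedy[where Q = "Qfam q t", OF greedy_policy_in_policies[of "Qfam q t"] Qt] by (simp only:)
  qed
  have "\<forall>t<T. Qfam q (Suc t) = H1 c p \<beta> \<rho> \<Omega> (Qfam q t) (flw q (Suc t)) \<and>
      flw q t = H2 p (greedy_policy (Qfam q (Suc t))) (flw q (Suc t))"
  proof (intro allI impI conjI)
    fix t assume t: "t < T"
    show "Qfam q (Suc t) = H1 c p \<beta> \<rho> \<Omega> (Qfam q t) (flw q (Suc t))"
      using H1[of "Suc t"] t by simp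
  qed (rule flow_step)
  then show "greedy_mfe q \<in> MFE c p \<beta> \<rho> \<Omega> T \<mu>init (Qfam q 0)"
    unfolding greedy_mfe_def MFE_def
    by (auto simp: greedy_policy_in_policies flow_start intro!: exI[of _ "Qfam q"] greedy)
qed

text \<open>Stationarity makes \<open>Q0\<close> regularized and Lipschitz, and the recursion
  carries this to all earlier times. The policies are then greedy, which identifies
  \<open>\<mu>\<close> with the flow.\<close>

lemma fixed_point_of_MFE:
  assumes mfe: "(\<pi>, \<mu>) \<in> MFE c p \<beta> \<rho> \<Omega> T \<mu>init Q0"
    and Q0: "Q0 = H1 c p \<beta> \<rho> \<Omega> Q0 (\<mu> 0)"
  obtains q where "lipschitz_fam q" "\<And>t. t \<le> T \<Longrightarrow> sweep q t = q t"
    "Q0 = Qfam q 0" "(\<pi>, \<mu>) = greedy_mfe q"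
proof -
  note mfe' = mfe[unfolded MFE_def mem_Collect_eq case_prod_conv]
  have pol: "\<pi> \<in> {..T} \<rightarrow>\<^sub>E policies" and ext: "\<mu> \<in> {..T} \<rightarrow>\<^sub>E UNIV" and init: "\<mu> T = \<mu>init"
    using mfe' by blast+
  obtain Q where start: "Q 0 = Q0"
    and steps: "\<forall>t<T. Q (Suc t) = H1 c p \<beta> \<rho> \<Omega> (Q t) (\<mu> (Suc t)) \<and>
      \<mu> t = H2 p (\<pi> (Suc t)) (\<mu> (Suc t))"
    and ae: "\<forall>t\<le>T. \<forall>x. AE u in \<pi> t x. is_arg_min (Q t x) (\<lambda>_. True) u"
    using mfe' by blast
  have step: "Q (Suc t) = H1 c p \<beta> \<rho> \<Omega> (Q t) (\<mu> (Suc t))"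
    and move: "\<mu> t = H2 p (\<pi> (Suc t)) (\<mu> (Suc t))" if "t < T" for t
    using steps that by blast+
  have "\<exists>f. lipschitz_cost L f \<and> Q t = (\<lambda>x. reg (f x))" if "t \<le> T" for t
    using that
  proof (induction t)
    case 0
    \<comment> \<open>\<open>Q0\<close> has the regularized form as a value of \<open>H1\<close>;
      inserting this form into the same equation yields a fixed point of
      \<open>bellman\<close>.\<close>
    obtain f where "H1 c p \<beta> \<rho> \<Omega> Q0 (\<mu> 0) = (\<lambda>x. reg (f x))" by (rule that[OF H1_eq_reg])
    with Q0 have f: "Q0 = (\<lambda>x. reg (f x))" by (rule trans)
    from Q0 have "(\<lambda>x. reg (f x)) = H1 c p \<beta> \<rho> \<Omega> (\<lambda>x. reg (f x)) (\<mu> 0)" unfolding f .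
    also have "\<dots> = (\<lambda>x. reg (bellman f (\<mu> 0) x))" by (rule H1_reg)
    finally have "f = bellman f (\<mu> 0)" by (rule reg_fam_inject)
    then show ?case using f start lipschitz_cost_fixed_point by blast
  next
    case (Suc t)
    then obtain f where "lipschitz_cost L f" "Q t = (\<lambda>x. reg (f x))" by auto
    then show ?case using step[of t] Suc.prems lipschitz_cost_bellman by (auto simp: H1_reg)
  qed
  then obtain q where q: "\<And>t. t \<le> T \<Longrightarrow> lipschitz_cost L (q t) \<and> Q t = (\<lambda>x. reg (q t x))"
    by metis
  have Qq: "Q t = Qfam q t" if "t \<le> T" for t using q that by (simp add: Qfam_def)
  have \<pi>: "\<pi> t = greedy_policy (Qfam q t)" if "t \<le> T" for t
  proof
    fix x
    show "\<pi> t x = greedy_policy (Qfam q t) x"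
      using AE_arg_min_iff_greedy[of "\<pi> t" "Qfam q t" x "q t x"] pol ae that
      by (simp add: Qq PiE_iff) (simp add: Qfam_def)
  qed
  have \<mu>: "\<mu> t = flw q t" if "t \<le> T" for t
    using that
  proof (induction rule: inc_induct)
    case base
    show ?case by (simp add: init flow_start)
  next
    case (step t)
    then show ?case using move[of t] \<pi>[of "Suc t"] by (simp add: flow_step)
  qed
  have "sweep q t = q t" if "t \<le> T" for t
  proof -
    have "Q t = H1 c p \<beta> \<rho> \<Omega> (Q (t - 1)) (\<mu> t)"
    proof (cases t)
      case 0
      show ?thesis unfolding 0 diff_0_eq_0 start by (rule Q0)
    next
      case (Suc s)
      then show ?thesis using step[of s] that by simp
    qed
    also have "\<dots> = (\<lambda>x. reg (sweep q t x))"
      using that q[of "t - 1"] by (simp add: H1_reg sweep_def \<mu>)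
    finally have "(\<lambda>x. reg (sweep q t x)) = (\<lambda>x. reg (q t x))" using q[OF that] by simp
    then show ?thesis by (rule reg_fam_inject)
  qed
  moreover have "lipschitz_fam q" using q by (simp add: lipschitz_fam_def)
  moreover have "Q0 = Qfam q 0" using start Qq by simp
  moreover have "(\<pi>, \<mu>) = greedy_mfe q"
  proof -
    have "\<pi> t = (\<lambda>t\<in>{..T}. greedy_policy (Qfam q t)) t" for t
      using \<pi> pol by (cases "t \<le> T") (auto simp: PiE_iff extensional_def)
    moreover have "\<mu> t = (\<lambda>t\<in>{..T}. flw q t) t" for t
      using \<mu> ext by (cases "t \<le> T") (auto simp: PiE_iff extensional_def)
    ultimately show ?thesis by (auto simp: greedy_mfe_def)
  qed
  ultimately show ?thesis using that by blast
qed

text \<open>Any equilibrium with stationary terminal function comes from a Lipschitz fixed point of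
  \<open>sweep\<close>, and there is only one on \<open>{..T}\<close>.\<close>

lemma greedy_mfe_unique:
  assumes "(\<pi>, \<mu>) \<in> MFE c p \<beta> \<rho> \<Omega> T \<mu>init Q0" "Q0 = H1 c p \<beta> \<rho> \<Omega> Q0 (\<mu> 0)"
    and q: "lipschitz_fam q" "\<And>t. t \<le> T \<Longrightarrow> sweep q t = q t"
  shows "(\<pi>, \<mu>) = greedy_mfe q \<and> Q0 = Qfam q 0"
proof -
  obtain r where r: "lipschitz_fam r" "\<And>t. t \<le> T \<Longrightarrow> sweep r t = r t"
    "Q0 = Qfam r 0" "(\<pi>, \<mu>) = greedy_mfe r"
    using fixed_point_of_MFE[OF assms(1,2)] by blast
  have "Qfam r = Qfam q"
    using sweep_fixed_point_unique[OF r(1) q(1) r(2) q(2)] by (auto simp: Qfam_def restrict_def)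
  then show ?thesis using r by (simp add: greedy_mfe_def)
qed

end

text \<open>\<open>y\<close> minimizes \<open>\<beta> y + g / (y - K)\<close> over \<open>y > K\<close>; the minimum is \<open>\<beta> K + 2 sqrt (\<beta> g)\<close>. If \<open>g = 0\<close> the
  infimum is not attained, and any \<open>y\<close> slightly above \<open>K\<close> will do.\<close>

lemma contraction_weight_ex:
  fixes \<beta> g K :: real
  assumes \<beta>: "0 < \<beta>" and g: "0 \<le> g" and K: "0 \<le> K"
    and small: "sqrt \<beta> * (sqrt (K + g) + sqrt g) < 1"
    and large: "1 \<le> K \<or> \<beta> * (1 - K)\<^sup>2 < g"
  shows "\<exists>y\<ge>1. K < y \<and> \<beta> * y + g / (y - K) < 1"
proof -
  define a b where "a = sqrt (\<beta> * g)" and "b = sqrt (\<beta> * (K + g))"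
  have ab: "a + b < 1" using small by (simp add: a_def b_def real_sqrt_mult ring_distribs(1)[of "sqrt _"])
  have nn: "0 \<le> a" "0 \<le> b" using \<beta> g K by (simp_all add: a_def b_def)
  \<comment> \<open>Squaring \<open>b < 1 - a\<close> cancels the square of \<open>a\<close> and
    leaves the statement that the minimum \<open>\<beta> * K + 2 * a\<close> is below 1.\<close>
  have "b\<^sup>2 < (1 - a)\<^sup>2" using ab nn by (intro power_strict_mono) auto
  moreover have "b\<^sup>2 = \<beta> * K + a\<^sup>2" using \<beta> g K by (simp add: a_def b_def distrib_left)
  ultimately have bound: "\<beta> * K + 2 * a < 1" by (simp add: power2_eq_square algebra_simps)
  show ?thesis
  proof (cases "g = 0")
    case True
    \<comment> \<open>For \<open>g = 0\<close> the second alternative of \<open>large\<close> is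
      impossible, so \<open>K \<ge> 1\<close> and every \<open>y > K\<close> is an admissible
      weight.\<close>
    have "\<not> \<beta> * (1 - K)\<^sup>2 < 0" using \<beta> by (simp add: not_less)
    then have "1 \<le> K" using large True by simp
    moreover have "K < 1 / \<beta>" using bound True \<beta> by (simp add: a_def field_simps)
    then obtain y where "K < y" "y < 1 / \<beta>" using dense by blast
    ultimately show ?thesis using True \<beta> by (intro exI[of _ y]) (simp add: field_simps)
  next
    case False
    with g have g: "0 < g" by simp
    define w where "w = sqrt (g / \<beta>)"
    have w: "0 < w" "w\<^sup>2 = g / \<beta>" using g \<beta> by (simp_all add: w_def)
    have gw: "g = \<beta> * w\<^sup>2" using w(2) \<beta> by simp
    then have "a = \<beta> * w"
      unfolding a_def using w(1) \<beta> by (intro real_sqrt_unique) (simp_all add: power2_eq_square)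
    moreover have "g / w = \<beta> * w" using w(1) gw by (simp add: power2_eq_square)
    ultimately have "\<beta> * (K + w) + g / ((K + w) - K) < 1" using bound by (simp add: distrib_left)
    \<comment> \<open>If \<open>K < 1\<close>, the second alternative of \<open>large\<close> says
      that \<open>w > 1 - K\<close>, so the minimizer already satisfies the constraint on the
      weight.\<close>
    moreover have "1 \<le> K + w"
    proof (cases "1 \<le> K")
      case False
      then have "(1 - K)\<^sup>2 < w\<^sup>2" using large \<beta> w by (simp add: pos_less_divide_eq mult.commute)
      then have "1 - K < w" using w(1) by (simp add: power_less_imp_less_base)
      then show ?thesis by simp
    qed (use w in simp)
    ultimately show ?thesis using w(1) by (intro exI[of _ "K + w"]) simp
  qed
qed

theorem theorem3:
  fixes c :: "'x::finite \<Rightarrow> 'a::finite \<Rightarrow> 'x pmf \<Rightarrow> real"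
    and p :: "'x \<Rightarrow> 'a \<Rightarrow> 'x pmf \<Rightarrow> 'x pmf"
    and \<Omega> :: "'a pmf \<Rightarrow> real"
    and \<beta> \<rho> L1 K1 :: real
    and T :: nat
    and \<mu>init :: "'x pmf"
  assumes "\<And>x a \<mu>. 0 \<le> c x a \<mu>"
    and "0 < \<beta>" "\<beta> < 1"
    and "0 < \<rho>"
    and "strongly_convex_1 \<Omega>"
    and "unique_minimizers \<rho> \<Omega>"
    and "lipschitz_model c p L1 K1"
    and "\<beta> * K1 < 2"
    and "sqrt \<beta> * (sqrt (KD K1 + Lbar \<beta> L1 K1 * K1 / \<rho>) + sqrt (Lbar \<beta> L1 K1 * K1 / \<rho>)) < 1"
    and "1 \<le> KD K1 \<or> \<beta> * (1 - KD K1)\<^sup>2 < Lbar \<beta> L1 K1 * K1 / \<rho>"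
  shows "(\<exists>!(\<pi>, \<mu>). \<exists>Q0. (\<pi>, \<mu>) \<in> MFE c p \<beta> \<rho> \<Omega> T \<mu>init Q0 \<and>
              Q0 = H1 c p \<beta> \<rho> \<Omega> Q0 (\<mu> 0)) \<and>
         (\<exists>N. Q_norm T N \<and>
            (\<exists>\<kappa>. 0 \<le> \<kappa> \<and> \<kappa> < 1 \<and>
               (\<forall>Q \<in> {..T} \<rightarrow>\<^sub>E C_beta c \<beta> \<rho> \<Omega> L1 K1. \<forall>R \<in> {..T} \<rightarrow>\<^sub>E C_beta c \<beta> \<rho> \<Omega> L1 K1.
                  N (Q_diff T (Phi c p \<beta> \<rho> \<Omega> T \<mu>init Q) (Phi c p \<beta> \<rho> \<Omega> T \<mu>init R))
                    \<le> \<kappa> * N (Q_diff T Q R))) \<and>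
            (\<forall>Q \<in> {..T} \<rightarrow>\<^sub>E C_beta c \<beta> \<rho> \<Omega> L1 K1.
               \<exists>Qfix \<in> bounded_Q_families T.
                  Phi c p \<beta> \<rho> \<Omega> T \<mu>init Qfix = Qfix \<and>
                  (\<lambda>n. N (Q_diff T ((Phi c p \<beta> \<rho> \<Omega> T \<mu>init ^^ n) Q) Qfix)) \<longlonglongrightarrow> 0 \<and>
                  (\<forall>\<pi> \<mu> Q0. (\<pi>, \<mu>) \<in> MFE c p \<beta> \<rho> \<Omega> T \<mu>init Q0 \<and>
                       Q0 = H1 c p \<beta> \<rho> \<Omega> Q0 (\<mu> 0) \<longrightarrow> Qfix 0 = Q0)))"
proof -
  interpret regularized_model c p \<Omega> \<beta> \<rho> L1 K1
    by unfold_locales (fact assms)+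
  have "0 \<le> L * K1 / \<rho>" "0 \<le> KD K1"
    using L_nonneg K1_nonneg assms(4) by (simp_all add: KD_def)
  then obtain y where "1 \<le> y" "KD K1 < y" "\<beta> * y + L * K1 / \<rho> / (y - KD K1) < 1"
    using contraction_weight_ex[OF assms(2) _ _ assms(9,10)] by blast
  then interpret contraction_model c p \<Omega> \<beta> \<rho> L1 K1 y T \<mu>init
    by unfold_locales
  obtain q where q: "lipschitz_fam q" "\<And>t. t \<le> T \<Longrightarrow> sweep q t = q t"
    using sweep_fixed_point_ex by blast
  note unique = greedy_mfe_unique[OF _ _ q]
  have fixed: "Phi c p \<beta> \<rho> \<Omega> T \<mu>init (Qfam q) = Qfam q"
    using q(2) unfolding Phi_Qfam by (auto simp: Qfam_def restrict_def)
  show ?thesis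
  \<comment> \<open>One norm, one factor and one fixed point serve all starting families.\<close>
  proof (intro conjI exI[of _ Q_sup] exI[of _ \<kappa>] ballI bexI[of _ "Qfam q"] allI impI)
    show "\<exists>!(\<pi>, \<mu>). \<exists>Q0. (\<pi>, \<mu>) \<in> MFE c p \<beta> \<rho> \<Omega> T \<mu>init Q0 \<and> Q0 = H1 c p \<beta> \<rho> \<Omega> Q0 (\<mu> 0)"
    proof (rule ex1I[of _ "greedy_mfe q"])
      show "case greedy_mfe q of (\<pi>, \<mu>) \<Rightarrow>
          \<exists>Q0. (\<pi>, \<mu>) \<in> MFE c p \<beta> \<rho> \<Omega> T \<mu>init Q0 \<and> Q0 = H1 c p \<beta> \<rho> \<Omega> Q0 (\<mu> 0)"
        using MFE_of_fixed_point[OF q(2)] by (auto simp: greedy_mfe_def)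
    qed (use unique in auto)
  next
    fix Q R assume QR: "Q \<in> {..T} \<rightarrow>\<^sub>E C_beta c \<beta> \<rho> \<Omega> L1 K1" "R \<in> {..T} \<rightarrow>\<^sub>E C_beta c \<beta> \<rho> \<Omega> L1 K1"
    obtain q' where "Q = Qfam q'" by (rule C_beta_fam[OF QR(1)])
    moreover obtain r where "lipschitz_fam r" "R = Qfam r" by (rule C_beta_fam[OF QR(2)])
    ultimately show "Q_sup (Q_diff T (Phi c p \<beta> \<rho> \<Omega> T \<mu>init Q) (Phi c p \<beta> \<rho> \<Omega> T \<mu>init R))
        \<le> \<kappa> * Q_sup (Q_diff T Q R)"
      by (simp add: Phi_contraction)
  next
    fix Q assume "Q \<in> {..T} \<rightarrow>\<^sub>E C_beta c \<beta> \<rho> \<Omega> L1 K1"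
    then obtain r where "Q = Qfam r" using C_beta_fam by blast
    then show "(\<lambda>n. Q_sup (Q_diff T ((Phi c p \<beta> \<rho> \<Omega> T \<mu>init ^^ n) Q) (Qfam q))) \<longlonglongrightarrow> 0"
      using Phi_iterates_converge[OF q(1) fixed] by simp
  next
    fix \<pi> \<mu> Q0
    assume "(\<pi>, \<mu>) \<in> MFE c p \<beta> \<rho> \<Omega> T \<mu>init Q0 \<and> Q0 = H1 c p \<beta> \<rho> \<Omega> Q0 (\<mu> 0)"
    then show "Qfam q 0 = Q0" using unique by blast
  qed (simp_all add: Q_norm_Q_sup kappa fixed Qfam_bounded)
qed

end
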